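(* Let $w\in\Sigma_2^\omega$ be an infinite binary word that is rich and $14/5$-free. Then for every integer $n\geq 1$, some suffix of $w$ has the form $f(h^n(w_n))$ or the form $f(g(h^n(w_n)))$ for some infinite word $w_n\in\Sigma_3^\omega$.
   Context: $\Sigma_k=\{0,1,\dots,k-1\}$. The morphisms $f:\Sigma_3^*\to\Sigma_2^*$ and $g,h:\Sigma_3^*\to\Sigma_3^*$ are defined by $f(0)=0$, $f(1)=01$, $f(2)=011$; $g(0)=011$, $g(1)=0121$, $g(2)=012121$; $h(0)=01$, $h(1)=02$, $h(2)=022$ (extended to infinite words letterwise). A finite word of length $n$ is rich if it has $n$ distinct nonempty palindromic factors; an infinite word is rich if all of its finite factors are rich. A finite word $u=u_1\cdots u_m$ has period $p$ if $u_i=u_{i+p}$ for $1\le i\le m-p$, and then $m/p$ is an exponent of $u$. For real $\alpha\ge1$, a word is $\alpha$-free if it contains no nonempty factor having an exponent $\ge\alpha$. *)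

theory Defs
  imports Complex_Main "HOL-Library.Stream" "HOL-Library.Sublist"
begin

text \<open>
  Finite words are lists and infinite words are streams. Letters are natural numbers, and
  the infinite words over the alphabet with \<open>k\<close> letters are \<open>streams (alphabet k)\<close>.
\<close>

definition alphabet :: "nat \<Rightarrow> nat set" where
  "alphabet k = {..<k}"

definition factors :: "'a stream \<Rightarrow> 'a list set" where
  "factors w = {stake n (sdrop m w) | m n. True}"

definition rich :: "'a list \<Rightarrow> bool" where
  "rich u \<longleftrightarrow> card {v. v \<noteq> [] \<and> sublist v u \<and> rev v = v} = length u"

definition rich_inf :: "'a stream \<Rightarrow> bool" where
  "rich_inf w \<longleftrightarrow> (\<forall>u \<in> factors w. rich u)"

text \<open>
  Periods are positive. A period exceeding the length is allowed, but it only yields an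
  exponent below 1, which does not affect \<open>\<alpha>\<close>-freeness for \<open>\<alpha> \<ge> 1\<close>.
\<close>

definition has_period :: "'a list \<Rightarrow> nat \<Rightarrow> bool" where
  "has_period u p \<longleftrightarrow> p \<ge> 1 \<and> (\<forall>i. i + p < length u \<longrightarrow> u ! i = u ! (i + p))"

definition is_exponent :: "'a list \<Rightarrow> real \<Rightarrow> bool" where
  "is_exponent u e \<longleftrightarrow> (\<exists>p. has_period u p \<and> e = real (length u) / real p)"

definition power_free :: "real \<Rightarrow> 'a stream \<Rightarrow> bool" where
  "power_free \<alpha> w \<longleftrightarrow> \<not> (\<exists>u \<in> factors w. u \<noteq> [] \<and> (\<exists>e. is_exponent u e \<and> e \<ge> \<alpha>))"

text \<open>
  A morphism is given by its values on letters. The extension to infinite words is the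
  intended one only for morphisms whose letter images are nonempty, because \<open>flat\<close> is
  unspecified on empty blocks; see \<open>apply_morph_SCons\<close>.
\<close>

definition apply_morph :: "('a \<Rightarrow> 'b list) \<Rightarrow> 'a stream \<Rightarrow> 'b stream" where
  "apply_morph \<phi> w = flat (smap \<phi> w)"

lemma apply_morph_SCons:
  "\<phi> a \<noteq> [] \<Longrightarrow> apply_morph \<phi> (a ## w) = \<phi> a @- apply_morph \<phi> w"
  by (simp add: apply_morph_def)

text \<open>The final branch of each case distinction is meant for the letter 2.\<close>

definition morph_f :: "nat \<Rightarrow> nat list" where
  "morph_f a = (if a = 0 then [0] else if a = 1 then [0,1] else [0,1,1])"

definition morph_g :: "nat \<Rightarrow> nat list" where
  "morph_g a = (if a = 0 then [0,1,1] else if a = 1 then [0,1,2,1] else [0,1,2,1,2,1])"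

definition morph_h :: "nat \<Rightarrow> nat list" where
  "morph_h a = (if a = 0 then [0,1] else if a = 1 then [0,2] else [0,2,2])"

end

(* All three morphisms have the form a |-> 0 p_a with distinct palindromes p_a that avoid 0. Hence a
   complete return to a palindrome in u maps, after appending a 0, to one in the image of u, and
   richness passes from the image to u. It is used in the form "complete returns to palindromes are
   palindromes". Erasing a prefix makes w = f(u), and a finite search over the words u with a rich and
   14/5-free f(u) shows that u eventually splits into h-blocks or into g-blocks. For the induction,
   let Phi be f h^n or f g h^n. If Phi(u) is 14/5-free, then u avoids a dozen short words, because the
   repetitions that they cause in Phi(u) extend to both sides over the common prefixes and suffixes
   of the images of letters, whose lengths have closed forms. Together with the return property of u
   this leaves only u that eventually split into h-blocks. *)
theory Submission
  imports Defs
begin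

section \<open>Factors, powers and returns to palindromes\<close>

text \<open>Being 14/5-free cannot be pulled back in the way the return property is:
  \<open>[2, 1, 2]\<close> has exponent only 3/2, yet its image contains a run of period
  \<open>length (\<Phi> 1)\<close> and exponent at least 14/5. So the induction keeps the freeness
  of the full image and lets \<open>\<Phi>\<close> grow by one \<open>morph_h\<close>, while the
  return property descends to the preimage each time. The estimates on runs must hold at all levels,
  which is why the extensions need exact lengths. For runs extended on both sides, the parameter
  \<open>k\<close>, in which the two bases differ, cancels. The map \<open>f\<close> itself has
  blocks too short for these estimates, so it is handled by the search, and the iteration starts
  from \<open>f h\<close> and \<open>f g\<close>. Words are excluded only from suffixes because a
  contradiction may use letters to the left of an occurrence.\<close>

lemma stream_eq_if_long_common_prefixes:
  assumes "\<And>n. \<exists>xs t t'. n \<le> length xs \<and> s = xs @- t \<and> s' = xs @- t'"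
  shows "s = s'"
proof -
  have "s !! n = s' !! n" for n
  proof -
    obtain xs t t' where "Suc n \<le> length xs" "s = xs @- t" "s' = xs @- t'"
      using assms by blast
    then show ?thesis by (simp add: shift_snth_less)
  qed
  then show ?thesis using smap_alt[of id s s'] by (simp add: stream.map_id)
qed

lemma factors_iff: "x \<in> factors w \<longleftrightarrow> (\<exists>p s. w = p @- x @- s)"
proof
  assume "x \<in> factors w"
  then obtain m n where "x = stake n (sdrop m w)" unfolding factors_def by blast
  then have "w = stake m w @- x @- sdrop n (sdrop m w)" by (simp only: stake_sdrop)
  then show "\<exists>p s. w = p @- x @- s" by blast
next
  assume "\<exists>p s. w = p @- x @- s"
  then obtain p s where w: "w = p @- x @- s" by blast
  have "x = stake (length x) (sdrop (length p) w)"
    by (simp add: w stake_shift sdrop_shift)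
  then show "x \<in> factors w" unfolding factors_def by blast
qed

lemma factors_sublist:
  assumes "x \<in> factors w" "sublist y x"
  shows "y \<in> factors w"
proof -
  obtain p s where "w = p @- x @- s" using assms(1) by (auto simp: factors_iff)
  moreover obtain a b where "x = a @ y @ b" using assms(2) by (auto simp: sublist_def)
  ultimately have "w = (p @ a) @- y @- (b @- s)" by simp
  then show ?thesis unfolding factors_iff by blast
qed

lemma factors_sdropD:
  assumes "x \<in> factors (sdrop k w)"
  shows "x \<in> factors w"
proof -
  obtain p s where "sdrop k w = p @- x @- s" using assms by (auto simp: factors_iff)
  then have "w = (stake k w @ p) @- x @- s" by (metis shift_append stake_sdrop)
  then show ?thesis unfolding factors_iff by blast
qed

lemma factors_sdrop_mono:
  assumes "x \<in> factors (sdrop l w)" "k \<le> l"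
  shows "x \<in> factors (sdrop k w)"
  using assms factors_sdropD[of x "l - k" "sdrop k w"] by (simp add: sdrop_add)

lemma factors_set:
  assumes "x \<in> factors w" "w \<in> streams A"
  shows "set x \<subseteq> A"
proof -
  obtain p s where "w = p @- x @- s" using assms(1) by (auto simp: factors_iff)
  then show ?thesis using assms(2) by (simp add: streams_iff_sset)
qed

lemma factors_extend_right:
  assumes "x \<in> factors w" "w \<in> streams A"
  shows "\<exists>c\<in>A. x @ [c] \<in> factors w"
proof -
  obtain p s where "w = p @- x @- s" using assms(1) by (auto simp: factors_iff)
  then have "w = p @- (x @ [shd s]) @- stl s" by simp
  then have "x @ [shd s] \<in> factors w" unfolding factors_iff by blast
  moreover from this have "shd s \<in> A" using factors_set[OF _ assms(2)] by fastforce
  ultimately show ?thesis by blast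
qed

lemma factors_extend_left:
  assumes "x \<in> factors (sdrop (Suc k) w)" "w \<in> streams A"
  shows "\<exists>c\<in>A. c # x \<in> factors (sdrop k w)"
proof -
  obtain p s where "sdrop (Suc k) w = p @- x @- s" using assms(1) by (auto simp: factors_iff)
  then have "stl (sdrop k w) = p @- x @- s" by (simp only: sdrop.simps sdrop_stl)
  then have "sdrop k w = (shd (sdrop k w) # p) @- x @- s" by (metis stream.collapse shift.simps(2))
  moreover obtain p' c where "shd (sdrop k w) # p = p' @ [c]"
    by (cases "shd (sdrop k w) # p" rule: rev_cases) auto
  ultimately have "sdrop k w = p' @- (c # x) @- s"
    by (metis append_Cons append_Nil shift_append)
  then have *: "c # x \<in> factors (sdrop k w)" unfolding factors_iff by blast
  then have "c \<in> A" using factors_set[OF factors_sdropD assms(2)] by fastforce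
  then show ?thesis using * by blast
qed

section \<open>Runs of exponent at least 14/5\<close>

lemma power_free_sdrop: "power_free \<alpha> w \<Longrightarrow> power_free \<alpha> (sdrop k w)"
  unfolding power_free_def by (blast dest: factors_sdropD)

text \<open>Periodicity is stated as the agreement of a prefix with a suffix, and the exponent bound
  in integers, so that both evaluate on concrete words.\<close>

lemma power_free_period:
  assumes "power_free (14/5) w" "u \<in> factors w" "1 \<le> p" "p \<le> length u"
    and "take (length u - p) u = drop p u" "14 * p \<le> 5 * length u"
  shows False
proof -
  have "u ! i = u ! (i + p)" if "i + p < length u" for i
  proof -
    have "u ! i = take (length u - p) u ! i" using that by simp
    also have "\<dots> = u ! (i + p)" using that assms(4,5) by (simp add: add.commute)
    finally show ?thesis .
  qed
  then have "is_exponent u (real (length u) / real p)"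
    using assms(3) by (auto simp: is_exponent_def has_period_def)
  moreover have "real (length u) / real p \<ge> 14/5"
  proof -
    have "real (14 * p) \<le> real (5 * length u)" using assms(6) of_nat_le_iff by blast
    then show ?thesis using assms(3) by (simp add: field_simps)
  qed
  moreover have "u \<noteq> []" using assms(3,4) by auto
  ultimately show False using assms(1,2) unfolding power_free_def by blast
qed

text \<open>The condition on \<open>m\<close> makes it a beginning of the infinite power of
  \<open>z\<close>, so \<open>m\<close> may be longer than \<open>z\<close>; \<open>s\<close>
  continues the same period to the left.\<close>

lemma power_free_run:
  assumes "power_free (14/5) w" "s @ z @ m \<in> factors w" "z \<noteq> []"
    and "suffix s z" "prefix m (z @ m)"
    and "14 * length z \<le> 5 * (length s + length z + length m)"
  shows False
proof -
  obtain e where e: "z = e @ s" using assms(4) by (auto simp: suffix_def)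
  obtain t where t: "z @ m = m @ t" using assms(5) by (auto simp: prefix_def)
  have "length t = length z" using arg_cong[OF t, of length] by simp
  then have "take (length (s @ z @ m) - length z) (s @ z @ m) = s @ m" by (simp add: t)
  moreover have "drop (length z) (s @ z @ m) = s @ m" by (simp add: e)
  moreover have "1 \<le> length z" using assms(3) by (cases z) auto
  ultimately show False
    using power_free_period[OF assms(1,2), of "length z"] assms(6) by simp
qed

section \<open>Richness and complete returns to palindromes\<close>

definition returns_palindromic :: "'a stream \<Rightarrow> bool" where
  "returns_palindromic w \<longleftrightarrow>
     (\<forall>r \<in> factors w. \<forall>q. q \<noteq> [] \<and> rev q = q \<and> prefix q r \<and> suffix q r \<and>
        (\<forall>a b. r = a @ q @ b \<longrightarrow> a = [] \<or> b = []) \<longrightarrow> rev r = r)"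

lemma returns_palindromicD:
  assumes "returns_palindromic w" "r \<in> factors w" "q \<noteq> []" "rev q = q" "prefix q r" "suffix q r"
    and "\<And>a b. r = a @ q @ b \<Longrightarrow> a = [] \<or> b = []"
  shows "rev r = r"
  using assms unfolding returns_palindromic_def by blast

definition palfactors :: "'a list \<Rightarrow> 'a list set" where
  "palfactors u = {v. v \<noteq> [] \<and> sublist v u \<and> rev v = v}"

lemma finite_palfactors: "finite (palfactors u)"
proof -
  have "palfactors u \<subseteq> set (sublists u)" by (auto simp: palfactors_def)
  then show ?thesis using finite_subset by blast
qed

text \<open>A new palindrome is a suffix. Of two new ones the shorter would be a suffix of the
  longer, by symmetry also a prefix of it, and so would already occur in \<open>u\<close>.\<close>

lemma palfactors_snoc:
  "\<exists>v. palfactors (u @ [x]) \<subseteq> insert v (palfactors u)"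
proof -
  let ?S = "{v \<in> palfactors (u @ [x]). v \<notin> palfactors u}"
  have suf: "suffix v (u @ [x])" if "v \<in> ?S" for v
    using that by (auto simp: palfactors_def sublist_snoc)
  have same_if_le: "v1 = v2" if v1: "v1 \<in> ?S" and v2: "v2 \<in> ?S" and le: "length v1 \<le> length v2" for v1 v2
  proof (rule ccontr)
    assume "v1 \<noteq> v2"
    have "suffix v1 v2" using suf[OF v1] suf[OF v2] le by (metis suffix_length_suffix)
    then have "prefix v1 v2"
      using v1 v2 by (auto simp: palfactors_def suffix_to_prefix)
    with \<open>v1 \<noteq> v2\<close> obtain t where t: "v2 = v1 @ t" "t \<noteq> []" by (auto simp: prefix_def)
    obtain e where "u @ [x] = e @ v1 @ t" using suf[OF v2] t by (auto simp: suffix_def)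
    then have "butlast (u @ [x]) = e @ v1 @ butlast t" using t(2) by (simp add: butlast_append)
    then have "u = e @ v1 @ butlast t" by simp
    then have "v1 \<in> palfactors u" using v1 by (auto simp: palfactors_def sublist_def)
    then show False using v1 by blast
  qed
  then have eq: "v1 = v2" if "v1 \<in> ?S" "v2 \<in> ?S" for v1 v2
    using that same_if_le[of v1 v2] same_if_le[of v2 v1] nat_le_linear[of "length v1" "length v2"]
    by argo
  show ?thesis
  proof (cases "?S = {}")
    case True
    then show ?thesis by blast
  next
    case False
    then obtain v where "v \<in> ?S" by blast
    then have "?S \<subseteq> {v}" using eq by blast
    then show ?thesis by blast
  qed
qed

lemma card_palfactors_le: "card (palfactors u) \<le> length u"
proof (induction u rule: rev_induct)
  case Nil
  have "palfactors ([] :: 'a list) = {}" by (auto simp: palfactors_def)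
  then show ?case by simp
next
  case (snoc x u)
  obtain v where "palfactors (u @ [x]) \<subseteq> insert v (palfactors u)"
    using palfactors_snoc[of u x] by auto
  then have "card (palfactors (u @ [x])) \<le> card (insert v (palfactors u))"
    by (simp add: card_mono finite_palfactors)
  also have "\<dots> \<le> Suc (card (palfactors u))" by (simp add: card_insert_if finite_palfactors)
  finally show ?case using snoc by simp
qed

text \<open>By counting, the last letter of \<open>r\<close> completes a palindrome \<open>v\<close>
  that does not occur earlier. It is longer than \<open>q\<close>, which already occurs as a prefix;
  hence \<open>q\<close> ends and, by symmetry, begins \<open>v\<close>. Since \<open>q\<close> has
  no inner occurrence, \<open>v\<close> is all of \<open>r\<close>.\<close>

lemma rich_return_palindromic:
  assumes "rich r" "q \<noteq> []" "rev q = q" "prefix q r" "suffix q r"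
    and once: "\<And>a b. r = a @ q @ b \<Longrightarrow> a = [] \<or> b = []"
  shows "rev r = r"
proof (cases "r = q")
  case True
  then show ?thesis using assms(3) by simp
next
  case False
  then obtain t where t: "r = q @ t" "t \<noteq> []" using assms(4) by (auto simp: prefix_def)
  define r' where "r' = q @ butlast t"
  have r: "r = r' @ [last t]" using t by (simp add: r'_def)
  have card: "card (palfactors r) = length r" using assms(1) by (simp add: rich_def palfactors_def)
  have "\<not> palfactors r \<subseteq> palfactors r'"
    using card card_palfactors_le[of r'] card_mono[OF finite_palfactors, of "palfactors r" r'] r
    by auto
  then obtain v where v: "v \<in> palfactors r" "v \<notin> palfactors r'" by blast
  then have pal: "rev v = v" and ne: "v \<noteq> []" and "\<not> sublist v r'" "suffix v r"
    by (auto simp: palfactors_def r sublist_snoc)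
  have "suffix q v"
  proof (rule ccontr)
    assume "\<not> suffix q v"
    then have "suffix v q"
      using \<open>suffix v r\<close> assms(5) suffix_same_cases by blast
    then have "sublist v r'" by (auto simp: r'_def suffix_def sublist_appendI)
    then show False using \<open>\<not> sublist v r'\<close> by blast
  qed
  then have "prefix q v" using pal assms(3) by (simp add: suffix_to_prefix)
  then obtain b where b: "v = q @ b" by (auto simp: prefix_def)
  obtain a where a: "r = a @ v" using \<open>suffix v r\<close> by (auto simp: suffix_def)
  from once[of a b] a b have "a = [] \<or> b = []" by simp
  then show ?thesis
  proof
    assume "a = []"
    then show ?thesis using a pal by simp
  next
    assume "b = []"
    then have "sublist v r'" using b by (simp add: r'_def)
    then show ?thesis using \<open>\<not> sublist v r'\<close> by blast
  qed
qed

lemma rich_inf_returns_palindromic: "rich_inf w \<Longrightarrow> returns_palindromic w"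
  unfolding rich_inf_def returns_palindromic_def by (blast intro: rich_return_palindromic)

lemma returns_palindromic_sdrop: "returns_palindromic w \<Longrightarrow> returns_palindromic (sdrop k w)"
  unfolding returns_palindromic_def by (blast dest: factors_sdropD)

section \<open>Desubstitution\<close>

lemma apply_morph_shift:
  assumes "\<And>a. \<phi> a \<noteq> []"
  shows "apply_morph \<phi> (xs @- s) = concat (map \<phi> xs) @- apply_morph \<phi> s"
  by (induction xs) (simp_all add: apply_morph_SCons assms)

lemma apply_morph_unfold:
  assumes "\<And>a. \<phi> a \<noteq> []"
  shows "apply_morph \<phi> s = concat (map \<phi> (stake n s)) @- apply_morph \<phi> (sdrop n s)"
  using apply_morph_shift[of \<phi> "stake n s" "sdrop n s", OF assms] by (simp only: stake_sdrop)

lemma length_concat_map_ge: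
  assumes "\<And>a. \<phi> a \<noteq> []"
  shows "length xs \<le> length (concat (map \<phi> xs))"
proof (induction xs)
  case (Cons a xs)
  have "1 \<le> length (\<phi> a)" using assms[of a] by (cases "\<phi> a") auto
  then show ?case using Cons by simp
qed simp

lemma apply_morph_compose:
  assumes "\<And>a. \<phi> a \<noteq> []" "\<And>a. \<psi> a \<noteq> []"
  shows "apply_morph (\<lambda>a. concat (map \<phi> (\<psi> a))) s = apply_morph \<phi> (apply_morph \<psi> s)"
proof (rule stream_eq_if_long_common_prefixes)
  fix n
  let ?\<chi> = "\<lambda>a. concat (map \<phi> (\<psi> a))"
  have ne: "?\<chi> a \<noteq> []" for a
    using length_concat_map_ge[of \<phi> "\<psi> a", OF assms(1)] assms(2)[of a] by fastforce
  have *: "concat (map \<phi> (concat (map \<psi> xs))) = concat (map ?\<chi> xs)" for xs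
    by (induction xs) simp_all
  have "apply_morph ?\<chi> s = concat (map ?\<chi> (stake n s)) @- apply_morph ?\<chi> (sdrop n s)"
    by (rule apply_morph_unfold[OF ne])
  moreover have "apply_morph \<phi> (apply_morph \<psi> s)
      = concat (map ?\<chi> (stake n s)) @- apply_morph \<phi> (apply_morph \<psi> (sdrop n s))"
    by (simp only: apply_morph_unfold[of \<psi> s n, OF assms(2)] apply_morph_shift[of \<phi>, OF assms(1)] *)
  moreover have "n \<le> length (concat (map ?\<chi> (stake n s)))"
    using length_concat_map_ge[of ?\<chi> "stake n s", OF ne] by simp
  ultimately show "\<exists>xs t t'. n \<le> length xs \<and> apply_morph ?\<chi> s = xs @- t \<and>
      apply_morph \<phi> (apply_morph \<psi> s) = xs @- t'" by blast
qed

text \<open>Reading off one block leaves a stream with the same invariant, so a choice of letter and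
  rest can be iterated forever; the iterates of the rest spell out the preimage.\<close>

lemma desubstitute:
  assumes ne: "\<And>a. \<phi> a \<noteq> []" and "P s"
    and step: "\<And>s. P s \<Longrightarrow> \<exists>a\<in>A. \<exists>s'. s = \<phi> a @- s' \<and> P s'"
  shows "\<exists>v\<in>streams A. s = apply_morph \<phi> v"
proof -
  from step have "\<forall>s. \<exists>a s'. P s \<longrightarrow> a \<in> A \<and> s = \<phi> a @- s' \<and> P s'" by blast
  then obtain a t where at: "\<And>s. P s \<Longrightarrow> a s \<in> A \<and> s = \<phi> (a s) @- t s \<and> P (t s)"
    by metis
  let ?v = "smap a (siterate t s)"
  have P: "P ((t ^^ n) s)" for n
    by (induction n) (simp_all add: at \<open>P s\<close>)
  then have "a ((t ^^ n) s) \<in> A" for n using at by blast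
  then have "?v \<in> streams A" by (auto simp: streams_iff_sset sset_siterate stream.set_map)
  moreover have "P s \<Longrightarrow> s = concat (map \<phi> (stake n (smap a (siterate t s)))) @- (t ^^ n) s" for n s
  proof (induction n arbitrary: s)
    case (Suc n)
    have "s = \<phi> (a s) @- t s" using at[OF Suc.prems] by blast
    also have "t s = concat (map \<phi> (stake n (smap a (siterate t (t s))))) @- (t ^^ n) (t s)"
      using Suc.IH[of "t s"] at[OF Suc.prems] by blast
    finally have "s = \<phi> (a s) @- concat (map \<phi> (stake n (smap a (siterate t (t s))))) @- (t ^^ n) (t s)" .
    moreover have "stake (Suc n) (smap a (siterate t s)) = a s # stake n (smap a (siterate t (t s)))"
      by (simp only: stake.simps stream.map_sel siterate.simps)
    moreover have "(t ^^ Suc n) s = (t ^^ n) (t s)" by (simp only: funpow_Suc_right o_apply)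
    ultimately show ?case by (simp only: list.map concat.simps shift_append)
  qed simp
  from this[OF \<open>P s\<close>] have "s = apply_morph \<phi> ?v"
  proof (intro stream_eq_if_long_common_prefixes)
    fix n
    let ?xs = "concat (map \<phi> (stake n ?v))"
    assume "s = concat (map \<phi> (stake n ?v)) @- (t ^^ n) s" for n
    then have "s = ?xs @- (t ^^ n) s" .
    moreover have "apply_morph \<phi> ?v = ?xs @- apply_morph \<phi> (sdrop n ?v)"
      by (rule apply_morph_unfold[OF ne])
    moreover have "n \<le> length ?xs"
      using length_concat_map_ge[of \<phi> "stake n ?v", OF ne] by simp
    ultimately show "\<exists>xs t t'. n \<le> length xs \<and> s = xs @- t \<and> apply_morph \<phi> ?v = xs @- t'"
      by blast
  qed
  ultimately show ?thesis by blast
qed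

text \<open>The letter \<open>z\<close> marks the block boundaries. Injectivity is restricted to
  \<open>A\<close> because the morphisms in question send all numbers from 2 on to the same
  block.\<close>

locale palindromic_morphism =
  fixes \<phi> :: "'a \<Rightarrow> 'b list" and z :: 'b and p :: "'a \<Rightarrow> 'b list" and A :: "'a set"
  assumes \<phi>_eq: "\<phi> a = z # p a"
    and rev_p: "rev (p a) = p a"
    and z_notin_p: "z \<notin> set (p a)"
    and inj_p: "inj_on p A"
begin

abbreviation \<phi>s :: "'a list \<Rightarrow> 'b list" where
  "\<phi>s x \<equiv> concat (map \<phi> x)"

lemma \<phi>_nonempty: "\<phi> a \<noteq> []"
  by (simp add: \<phi>_eq)

lemma rev_image: "rev (\<phi>s x @ [z]) = \<phi>s (rev x) @ [z]"
  by (induction x) (simp_all add: \<phi>_eq rev_p)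

lemma image_starts: "\<exists>t. \<phi>s x @ [z] = z # t"
  by (cases x) (simp_all add: \<phi>_eq)

text \<open>The marker opens every block and occurs nowhere else, so each occurrence is a cut
  between letters of \<open>r\<close>. The appended \<open>z\<close> supplies the cut after the last
  letter.\<close>

lemma image_split:
  assumes "\<phi>s r @ [z] = u @ z # v"
  shows "\<exists>a b. r = a @ b \<and> u = \<phi>s a \<and> z # v = \<phi>s b @ [z]"
  using assms
proof (induction r arbitrary: u)
  case Nil
  then show ?case by (cases u) auto
next
  case (Cons c r)
  show ?case
  proof (cases u)
    case Nil
    then show ?thesis using Cons.prems by (intro exI[of _ "[]"] exI[of _ "c # r"]) simp
  next
    case (Cons d u')
    have "z # p c @ \<phi>s r @ [z] = u @ z # v" using Cons.prems by (simp add: \<phi>_eq[of c])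
    then have "z # p c @ \<phi>s r @ [z] = d # u' @ z # v" by (simp only: Cons append_Cons)
    then have d: "d = z" and eq: "p c @ \<phi>s r @ [z] = u' @ z # v" by auto
    have "\<exists>w. u' = p c @ w \<and> \<phi>s r @ [z] = w @ z # v"
    proof -
      from eq obtain w where "p c = u' @ w \<and> w @ \<phi>s r @ [z] = z # v
          \<or> p c @ w = u' \<and> \<phi>s r @ [z] = w @ z # v"
        by (auto simp: append_eq_append_conv2)
      then show ?thesis
      proof
        assume *: "p c = u' @ w \<and> w @ \<phi>s r @ [z] = z # v"
        then have "w = []" using z_notin_p[of c] by (cases w) auto
        then show ?thesis using * by simp
      qed auto
    qed
    then obtain w where w: "u' = p c @ w" "\<phi>s r @ [z] = w @ z # v" by blast
    from Cons.IH[OF w(2)] obtain a b where "r = a @ b" "w = \<phi>s a" "z # v = \<phi>s b @ [z]" by blast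
    then show ?thesis using Cons d w(1)
      by (metis \<phi>_eq append_Cons append_assoc concat.simps(2) list.map(2))
  qed
qed

lemma image_inj:
  assumes "set x \<subseteq> A" "set y \<subseteq> A" "\<phi>s x = \<phi>s y"
  shows "x = y"
  using assms
proof (induction x arbitrary: y)
  case Nil
  then show ?case by (cases y) (simp_all add: \<phi>_eq)
next
  case (Cons a x)
  then obtain b y' where y: "y = b # y'" by (cases y) (simp_all add: \<phi>_eq)
  \<comment> \<open>The first block is recovered as the part before the next marker.\<close>
  have take: "takeWhile (\<lambda>c. c \<noteq> z) (p c @ \<phi>s w @ [z]) = p c" for c w
  proof -
    obtain t where "\<phi>s w @ [z] = z # t" using image_starts by blast
    then have "takeWhile (\<lambda>c. c \<noteq> z) (\<phi>s w @ [z]) = []" by simp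
    moreover have "takeWhile (\<lambda>c. c \<noteq> z) (p c @ \<phi>s w @ [z])
        = p c @ takeWhile (\<lambda>c. c \<noteq> z) (\<phi>s w @ [z])"
      using z_notin_p[of c] by (intro takeWhile_append2) auto
    ultimately show ?thesis by simp
  qed
  from Cons.prems(3) have eq: "p a @ \<phi>s x @ [z] = p b @ \<phi>s y' @ [z]" by (simp add: y \<phi>_eq[of a] \<phi>_eq[of b])
  then have "p a = p b" using take[of a x] take[of b y'] by metis
  then have "a = b" using inj_p Cons.prems(1,2) y by (auto dest: inj_onD)
  then show ?case using eq Cons y by simp
qed

lemma factor_image:
  assumes "x \<in> factors u" "u \<in> streams A"
  shows "\<phi>s x @ [z] \<in> factors (apply_morph \<phi> u)"
proof -
  obtain c where "x @ [c] \<in> factors u" using factors_extend_right[OF assms] by blast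
  then obtain q s where "u = q @- (x @ [c]) @- s" by (auto simp: factors_iff)
  then have "apply_morph \<phi> u = \<phi>s q @- (\<phi>s x @ [z]) @- (p c @- apply_morph \<phi> s)"
    by (simp add: apply_morph_shift apply_morph_SCons \<phi>_nonempty) (simp add: \<phi>_eq)
  then show ?thesis unfolding factors_iff by blast
qed

text \<open>Appending \<open>z\<close> turns a palindrome \<open>q\<close> into the palindrome
  \<open>\<phi>s q @ [z]\<close>. This word begins and ends with the marker, so its occurrences in
  \<open>\<phi>s r @ [z]\<close> are aligned with blocks and come from occurrences of
  \<open>q\<close> in \<open>r\<close>.\<close>

lemma returns_palindromic_preimage:
  assumes u: "u \<in> streams A" and "returns_palindromic (apply_morph \<phi> u)"
  shows "returns_palindromic u"
  unfolding returns_palindromic_def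
proof (intro ballI allI impI, elim conjE)
  fix r q
  assume r: "r \<in> factors u" and q: "q \<noteq> []" "rev q = q" "prefix q r" "suffix q r"
    and once: "\<forall>a b. r = a @ q @ b \<longrightarrow> a = [] \<or> b = []"
  have rA: "set r \<subseteq> A" using factors_set[OF r u] .
  have qA: "set q \<subseteq> A" using rA q(3) by (auto simp: prefix_def)
  let ?r = "\<phi>s r @ [z]" and ?q = "\<phi>s q @ [z]"
  obtain t where t: "?q = z # t" using image_starts by blast
  have "prefix ?q ?r"
  proof -
    obtain x where "r = q @ x" using q(3) by (auto simp: prefix_def)
    moreover obtain y where "\<phi>s x @ [z] = z # y" using image_starts by blast
    ultimately have "?r = ?q @ y" by simp
    then show ?thesis by simp
  qed
  moreover have "suffix ?q ?r" using q(4) by (auto simp: suffix_def)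
  moreover have "a = [] \<or> b = []" if eq: "?r = a @ ?q @ b" for a b
  proof -
    from eq have "?r = a @ z # (t @ b)" by (simp add: t)
    from image_split[OF this] obtain a' b' where
      1: "r = a' @ b'" "a = \<phi>s a'" "z # t @ b = \<phi>s b' @ [z]" by blast
    moreover have "z # t @ b = \<phi>s q @ z # b" using arg_cong[OF t, of "\<lambda>x. x @ b"] by simp
    ultimately have "\<phi>s b' @ [z] = \<phi>s q @ z # b" by simp
    from image_split[OF this] obtain c d where
      2: "b' = c @ d" "\<phi>s q = \<phi>s c" "z # b = \<phi>s d @ [z]" by blast
    have "q = c" using image_inj[OF qA _ 2(2)] rA 1 2 by simp
    then have "r = a' @ q @ d" using 1 2 by simp
    then have "a' = [] \<or> d = []" using once by blast
    then show ?thesis using 1 2 by auto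
  qed
  moreover have "?q \<noteq> []" "rev ?q = ?q" using rev_image[of q] q(2) by simp_all
  ultimately have "rev ?r = ?r"
    using assms(2) factor_image[OF r u] unfolding returns_palindromic_def by blast
  then have "\<phi>s (rev r) = \<phi>s r" using rev_image[of r] by simp
  then show "rev r = r" using image_inj[of "rev r" r] rA by simp
qed

end

lemma alphabet_3: "alphabet 3 = {0, 1, 2}"
  by (auto simp: alphabet_def)

interpretation f: palindromic_morphism morph_f 0
  "\<lambda>a. if a = 0 then [] else if a = 1 then [1] else [1, 1]" "alphabet 3"
  by unfold_locales (auto simp: morph_f_def alphabet_3 inj_on_def)

interpretation g: palindromic_morphism morph_g 0
  "\<lambda>a. if a = 0 then [1, 1] else if a = 1 then [1, 2, 1] else [1, 2, 1, 2, 1]" "alphabet 3"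
  by unfold_locales (auto simp: morph_g_def alphabet_3 inj_on_def)

interpretation h: palindromic_morphism morph_h 0
  "\<lambda>a. if a = 0 then [1] else if a = 1 then [2] else [2, 2]" "alphabet 3"
  by unfold_locales (auto simp: morph_h_def alphabet_3 inj_on_def)

lemma return_to_letter:
  assumes "returns_palindromic u" "x # ys @ [x] \<in> factors u" "x \<notin> set ys"
  shows "rev ys = ys"
proof -
  have "a = [] \<or> b = []" if eq: "x # ys @ [x] = a @ [x] @ b" for a b
  proof (rule ccontr)
    assume "\<not> (a = [] \<or> b = [])"
    then have ne: "a \<noteq> []" "b \<noteq> []" by auto
    obtain a' where a: "a = x # a'" using eq ne(1) by (auto simp: Cons_eq_append_conv)
    obtain b' y where b: "b = b' @ [y]" using ne(2) by (cases b rule: rev_cases) auto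
    have "ys = a' @ x # b'" using eq a b by simp
    then show False using assms(3) by simp
  qed
  moreover have "suffix [x] (x # ys @ [x])" by (simp add: suffix_def)
  ultimately have "rev (x # ys @ [x]) = x # ys @ [x]"
    by (intro returns_palindromicD[OF assms(1,2), of "[x]"]) auto
  then show ?thesis by simp
qed

lemma streams_sdrop:
  assumes "w \<in> streams A"
  shows "sdrop n w \<in> streams A"
proof -
  have "sset (stake n w @- sdrop n w) \<subseteq> A"
    using assms by (simp only: stake_sdrop streams_iff_sset)
  then show ?thesis by (simp add: streams_iff_sset)
qed

lemma factors_shift: "x \<in> factors (x @- s)"
proof -
  have "x @- s = [] @- x @- s" by simp
  then show ?thesis unfolding factors_iff by blast
qed

lemma factors_SCons: "x \<in> factors s \<Longrightarrow> x \<in> factors (a ## s)"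
  using factors_sdropD[of x 1 "a ## s"] by simp

text \<open>Between two zeros only \<open>1\<close>, \<open>2\<close> and \<open>22\<close> remain,
  which are the blocks of \<open>h\<close> without their zero. A zero is met after at most two
  letters.\<close>

lemma h_image_suffix:
  assumes "w \<in> streams (alphabet 3)"
    and "factors w \<inter> {[0, 0], [1, 1], [1, 2], [2, 1], [2, 2, 2]} = {}"
  shows "\<exists>i. \<exists>v\<in>streams (alphabet 3). sdrop i w = apply_morph morph_h v"
proof -
  define Q where "Q v \<longleftrightarrow> v \<in> streams (alphabet 3) \<and>
    factors v \<inter> {[0, 0], [1, 1], [1, 2], [2, 1], [2, 2, 2]} = {}" for v
  have Q_w: "Q w" using assms by (simp add: Q_def)
  have Q_stl: "Q v" if "Q (a ## v)" for a v
  proof -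
    have "factors v \<subseteq> factors (a ## v)" by (auto intro: factors_SCons)
    then show ?thesis using that unfolding Q_def streams_Stream by auto
  qed
  have Q_start: "(a = 0 \<or> a = 1 \<or> a = 2) \<and> (a = 0 \<longrightarrow> b \<noteq> 0) \<and> (a = 1 \<longrightarrow> b \<noteq> 1 \<and> b \<noteq> 2) \<and>
      (a = 2 \<longrightarrow> b \<noteq> 1) \<and> (a = 2 \<and> b = 2 \<longrightarrow> c \<noteq> 2)"
    if "Q (a ## b ## c ## v)" for a b c v
  proof -
    have "[a, b] \<in> factors (a ## b ## c ## v)" "[a, b, c] \<in> factors (a ## b ## c ## v)"
      using factors_shift[of "[a, b]" "c ## v"] factors_shift[of "[a, b, c]" v] by simp_all
    then show ?thesis using that by (auto simp: Q_def streams_Stream alphabet_3)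
  qed
  have "\<exists>a\<in>alphabet 3. \<exists>r. v = morph_h a @- r \<and> Q r \<and> shd r = 0" if v: "Q v \<and> shd v = 0" for v
  proof -
    obtain a b c d e f r where "v = a ## b ## c ## d ## e ## f ## r"
      by (metis stream.collapse)
    then have v_eq: "v = 0 ## b ## c ## d ## e ## f ## r" using v by simp
    have Q1: "Q (b ## c ## d ## e ## f ## r)" using v v_eq Q_stl by blast
    have Q2: "Q (c ## d ## e ## f ## r)" using Q1 Q_stl by blast
    have Q3: "Q (d ## e ## f ## r)" using Q2 Q_stl by blast
    have "b = 1 \<and> c = 0 \<or> b = 2 \<and> c = 0 \<or> b = 2 \<and> c = 2 \<and> d = 0"
      using Q_start[of 0 b c "d ## e ## f ## r"] Q_start[OF Q1] Q_start[OF Q2] Q_start[OF Q3] v v_eq by auto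
    then have "v = morph_h 0 @- c ## d ## e ## f ## r \<and> c = 0 \<or> v = morph_h 1 @- c ## d ## e ## f ## r \<and> c = 0
        \<or> v = morph_h 2 @- d ## e ## f ## r \<and> d = 0"
      using v_eq by (auto simp: morph_h_def)
    then show ?thesis using Q2 Q3 by (force simp: alphabet_3)
  qed
  then have image: "\<exists>v\<in>streams (alphabet 3). s = apply_morph morph_h v" if "Q s \<and> shd s = 0" for s
    using that by (intro desubstitute[of morph_h "\<lambda>v. Q v \<and> shd v = 0"] h.\<phi>_nonempty)
  obtain a b c d e r where w_eq: "w = a ## b ## c ## d ## e ## r" by (metis stream.collapse)
  have Q1: "Q (b ## c ## d ## e ## r)" using Q_w w_eq Q_stl by blast
  have Q2: "Q (c ## d ## e ## r)" using Q1 Q_stl by blast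
  have "a = 0 \<or> b = 0 \<or> c = 0"
    using Q_start[of a b c "d ## e ## r"] Q_start[OF Q1] Q_start[OF Q2] Q_w w_eq by auto
  then have "\<exists>i. Q (sdrop i w) \<and> shd (sdrop i w) = 0"
  proof (elim disjE)
    assume "a = 0"
    then show ?thesis using Q_w w_eq by (intro exI[of _ 0]) simp
  next
    assume "b = 0"
    then show ?thesis using Q1 w_eq by (intro exI[of _ 1]) simp
  next
    assume "c = 0"
    then show ?thesis using Q2 w_eq by (intro exI[of _ 2]) (simp add: numeral_2_eq_2)
  qed
  then show ?thesis using image by blast
qed

section \<open>Refutation by a finite search\<close>

text \<open>A certificate that a word dies out: a node branches over the three extensions on one
  side, and a leaf carries the evidence against the word reached.\<close>

datatype 'l search_tree =
    Leaf 'l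
  | Right "'l search_tree" "'l search_tree" "'l search_tree"
  | Left "'l search_tree" "'l search_tree" "'l search_tree"

primrec refutes :: "('l \<Rightarrow> nat list \<Rightarrow> bool) \<Rightarrow> 'l search_tree \<Rightarrow> nat list \<Rightarrow> bool" where
  "refutes bad (Leaf l) x \<longleftrightarrow> bad l x"
| "refutes bad (Right t0 t1 t2) x \<longleftrightarrow>
     refutes bad t0 (x @ [0]) \<and> refutes bad t1 (x @ [1]) \<and> refutes bad t2 (x @ [2])"
| "refutes bad (Left t0 t1 t2) x \<longleftrightarrow>
     refutes bad t0 (0 # x) \<and> refutes bad t1 (1 # x) \<and> refutes bad t2 (2 # x)"

text \<open>An occurrence always extends to the right, but to the left only if it is not at the very
  start. Each \<open>Left\<close> therefore costs one more erased letter.\<close>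

lemma refutes_sound:
  assumes "w \<in> streams (alphabet 3)" and "\<And>l x. bad l x \<Longrightarrow> x \<notin> factors w"
    and "refutes bad t x"
  shows "\<exists>k. x \<notin> factors (sdrop k w)"
  using assms(3)
proof (induction t arbitrary: x)
  case (Leaf l)
  then show ?case using assms(2) by (auto intro: exI[of _ 0])
next
  case (Right t0 t1 t2)
  then obtain k0 k1 k2 where "x @ [0] \<notin> factors (sdrop k0 w)" "x @ [1] \<notin> factors (sdrop k1 w)"
    "x @ [2] \<notin> factors (sdrop k2 w)" by (metis refutes.simps(2))
  then have "\<forall>c\<in>alphabet 3. x @ [c] \<notin> factors (sdrop (k0 + k1 + k2) w)"
    using factors_sdrop_mono[of _ "k0 + k1 + k2" w] by (auto simp: alphabet_3)
  then have "x \<notin> factors (sdrop (k0 + k1 + k2) w)"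
    using factors_extend_right streams_sdrop[OF assms(1)] by blast
  then show ?case by blast
next
  case (Left t0 t1 t2)
  then obtain k0 k1 k2 where "0 # x \<notin> factors (sdrop k0 w)" "1 # x \<notin> factors (sdrop k1 w)"
    "2 # x \<notin> factors (sdrop k2 w)" by (metis refutes.simps(3))
  then have "\<forall>c\<in>alphabet 3. c # x \<notin> factors (sdrop (k0 + k1 + k2) w)"
    using factors_sdrop_mono[of _ "k0 + k1 + k2" w] by (auto simp: alphabet_3)
  then have "x \<notin> factors (sdrop (Suc (k0 + k1 + k2)) w)"
    using factors_extend_left assms(1) by blast
  then show ?case by blast
qed

lemma finitely_many_factors_vanish:
  assumes "finite X" "\<And>x. x \<in> X \<Longrightarrow> \<exists>k. x \<notin> factors (sdrop k w)"
  shows "\<exists>k. factors (sdrop k w) \<inter> X = {}"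
  using assms
proof (induction X)
  case (insert x X)
  obtain k where "factors (sdrop k w) \<inter> X = {}" using insert.IH insert.prems by auto
  moreover obtain k' where "x \<notin> factors (sdrop k' w)" using insert.prems by auto
  ultimately have "factors (sdrop (k + k') w) \<inter> insert x X = {}"
    using factors_sdrop_mono[of _ "k + k'" w k] factors_sdrop_mono[of _ "k + k'" w k'] by auto
  then show ?case by blast
qed simp

section \<open>The induction step\<close>

text \<open>Here \<open>\<Phi>\<close> stands for \<open>f \<circ> h\<^sup>n\<close> or \<open>f \<circ> g \<circ> h\<^sup>n\<close>. The words \<open>l\<close> and \<open>m\<close> begin
  the images of all words and of the words not starting with \<open>0\<close>, respectively; \<open>s\<close> and \<open>t\<close> play
  the same role at the end. They prolong the repetitions in \<open>\<Phi>(u)\<close> that come from repetitions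
  in \<open>u\<close>. The length identities are the solution of the recurrences in \<open>level_h\<close>; the
  parameter \<open>k\<close> only depends on the base of the iteration.\<close>

locale level =
  fixes \<Phi> :: "nat \<Rightarrow> nat list" and l m s t :: "nat list" and k :: nat
  assumes nonempty: "\<Phi> x \<noteq> []"
    and l_prefix: "prefix l (\<Phi> x @ l)"
    and m_prefix: "x \<noteq> 0 \<Longrightarrow> prefix m (\<Phi> x @ l)"
    and s_suffix: "suffix s (\<Phi> x)"
    and t_suffix: "x \<noteq> 0 \<Longrightarrow> suffix t (\<Phi> x)"
    and length_2: "length (\<Phi> 2) = length (\<Phi> 0) + length (\<Phi> 1)"
    and length_l: "2 * length l + k = length (\<Phi> 0) + length (\<Phi> 1)"
    and length_m: "2 * length m + k = length (\<Phi> 0) + 2 * length (\<Phi> 1)"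
    and length_s: "2 * length s + 2 = length (\<Phi> 0) + k"
    and length_t: "2 * length t + 2 = length (\<Phi> 0) + length (\<Phi> 1) + k"
    and length_bounds: "3 \<le> length (\<Phi> 0)" "k \<le> length (\<Phi> 0)"
      "length (\<Phi> 0) + k \<le> length (\<Phi> 1)" "length (\<Phi> 1) \<le> 2 * length (\<Phi>
        0)"
begin

lemma l_prefix_m: "prefix l m"
proof -
  have "length l \<le> length m" using length_l length_m by linarith
  then show ?thesis
    using prefix_length_prefix[OF l_prefix[of 1] m_prefix[of 1]] by simp
qed

lemma l_prefix_image: "prefix l (concat (map \<Phi> xs) @ l)"
proof (induction xs)
  case (Cons x xs)
  have "prefix (\<Phi> x @ l) (concat (map \<Phi> (x # xs)) @ l)" using Cons by simp
  then show ?case using l_prefix[of x] prefix_order.trans by blast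
qed simp

lemma l_prefix_image_m: "prefix l (concat (map \<Phi> xs) @ m)"
  using l_prefix_image[of xs] l_prefix_m by (metis prefix_order.trans same_prefix_prefix)

lemma m_prefix_image_m:
  assumes "x \<noteq> 0"
  shows "prefix m (\<Phi> x @ concat (map \<Phi> xs) @ m)"
proof -
  have "prefix (\<Phi> x @ l) (\<Phi> x @ concat (map \<Phi> xs) @ m)" using l_prefix_image_m[of
    xs] by simp
  then show ?thesis using m_prefix[OF assms] prefix_order.trans by blast
qed

lemma factor_image_l:
  assumes "x \<in> factors u"
  shows "concat (map \<Phi> x) @ l \<in> factors (apply_morph \<Phi> u)"
proof -
  obtain p r where "u = p @- x @- r" using assms by (auto simp: factors_iff)
  then have u: "apply_morph \<Phi> u = concat (map \<Phi> p) @- concat (map \<Phi> x) @-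
    apply_morph \<Phi> r"
    by (simp add: apply_morph_shift nonempty)
  \<comment> \<open>\<open>l\<close> may be longer than the image of one letter. As images are
    nonempty, those of \<open>length l\<close> letters cover it.\<close>
  let ?y = "concat (map \<Phi> (stake (length l) r))"
  have "length l \<le> length ?y"
    using length_concat_map_ge[of \<Phi> "stake (length l) r"] nonempty by simp
  then have "prefix l ?y"
    using prefix_length_prefix[OF l_prefix_image[of "stake (length l) r"], of ?y] by simp
  then obtain y where "?y = l @ y" by (auto simp: prefix_def)
  then have "apply_morph \<Phi> r = l @- y @- apply_morph \<Phi> (sdrop (length l) r)"
    using apply_morph_unfold[of \<Phi> r "length l"] nonempty by simp
  then have "apply_morph \<Phi> u = concat (map \<Phi> p) @- (concat (map \<Phi> x) @ l) @-
      y @- apply_morph \<Phi> (sdrop (length l) r)" using u by simp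
  then show ?thesis unfolding factors_iff by blast
qed

lemma factor_image_m:
  assumes "x @ [c] \<in> factors u" "c \<noteq> 0"
  shows "concat (map \<Phi> x) @ m \<in> factors (apply_morph \<Phi> u)"
proof -
  have "concat (map \<Phi> x) @ \<Phi> c @ l \<in> factors (apply_morph \<Phi> u)"
    using factor_image_l[OF assms(1)] by simp
  moreover obtain y where "\<Phi> c @ l = m @ y" using m_prefix[OF assms(2)] by (auto simp:
    prefix_def)
  ultimately have "(concat (map \<Phi> x) @ m) @ y \<in> factors (apply_morph \<Phi> u)" by simp
  then show ?thesis by (rule factors_sublist) simp
qed

text \<open>A block of \<open>h\<close> is \<open>0\<close> followed by a nonzero letter and ends in
  a nonzero letter; this gives the new \<open>l\<close> and \<open>s\<close>. Blocks of nonzero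
  letters begin with \<open>02\<close> and end with \<open>02\<close> or \<open>22\<close>; this
  gives the new \<open>m\<close> and \<open>t\<close>.\<close>

lemma level_h:
  "level (\<lambda>x. concat (map \<Phi> (morph_h x))) (\<Phi> 0 @ m) (\<Phi> 0 @ \<Phi> 2 @ l) t
    (s @ \<Phi> 2) k"
proof
  note [simp] = morph_h_def
  fix x :: nat
  show "concat (map \<Phi> (morph_h x)) \<noteq> []" using nonempty by simp
  show "prefix (\<Phi> 0 @ m) (concat (map \<Phi> (morph_h x)) @ \<Phi> 0 @ m)"
    using m_prefix_image_m[of 1 "[0]"] m_prefix_image_m[of 2 "[0]"] m_prefix_image_m[of 2 "[2, 0]"]
    by simp
  show "prefix (\<Phi> 0 @ \<Phi> 2 @ l) (concat (map \<Phi> (morph_h x)) @ \<Phi> 0 @ m)" if "x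
    \<noteq> 0"
    using that l_prefix_image_m[of "[0]"] l_prefix_image_m[of "[2, 0]"] by simp
  show "suffix t (concat (map \<Phi> (morph_h x)))"
    using t_suffix[of 1] t_suffix[of 2] by (simp add: suffix_appendI)
  show "suffix (s @ \<Phi> 2) (concat (map \<Phi> (morph_h x)))" if "x \<noteq> 0"
    using that s_suffix[of 0] s_suffix[of 2] by (simp add: suffix_appendI)
qed (use length_2 length_l length_m length_s length_t length_bounds in \<open>simp_all add:
  morph_h_def\<close>)

context
  fixes u :: "nat stream"
  assumes free: "power_free (14/5) (apply_morph \<Phi> u)"
begin

lemma no_run:
  assumes "sublist (v @ z @ y) x" "x \<in> factors (apply_morph \<Phi> u)" "z \<noteq> []"
    and "suffix v z" "prefix y (z @ y)"
    and "14 * length z \<le> 5 * (length v + length z + length y)"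
  shows False
  using power_free_run[OF free factors_sublist[OF assms(2,1)] assms(3-6)] .

lemma sublist_suffix_append:
  assumes "suffix v x"
  shows "sublist (v @ y) (x @ y)"
  using assms by (auto simp: suffix_def)

lemma no_00: "[0, 0] \<notin> factors u"
proof
  assume "[0, 0] \<in> factors u"
  from factor_image_l[OF this] show False
    by (intro no_run[of "[]" "\<Phi> 0" "\<Phi> 0 @ l"])
      (use nonempty l_prefix length_l length_bounds in auto)
qed

text \<open>Let A and B be the lengths of \<open>\<Phi> 0\<close> and \<open>\<Phi> 1\<close>. The
  letter \<open>c\<close> contributes \<open>s\<close>, the continuation contributes
  \<open>l\<close>, and the run has length A + 5/2 B - 1. This is at least 14/5 B because B \<le> 2
  A and 3 \<le> A.\<close>

lemma no_11: "[c, 1, 1] \<notin> factors u"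
proof
  assume "[c, 1, 1] \<in> factors u"
  from factor_image_l[OF this] show False
    by (intro no_run[of s "\<Phi> 1" "\<Phi> 1 @ l"])
      (use nonempty l_prefix s_suffix length_l length_s length_bounds in
        \<open>auto intro: sublist_suffix_append\<close>)
qed

lemma no_222: "[2, 2, 2] \<notin> factors u"
proof
  assume "[2, 2, 2] \<in> factors u"
  from factor_image_l[OF this] show False
    by (intro no_run[of "[]" "\<Phi> 2" "\<Phi> 2 @ \<Phi> 2"]) (use nonempty in auto)
qed

text \<open>The run is one letter short of a cube, whatever \<open>k\<close> is. The same count
  returns in \<open>no_221\<close> and \<open>no_1010\<close>.\<close>

lemma no_122: "[1, 2, 2] \<notin> factors u"
proof
  assume "[1, 2, 2] \<in> factors u"
  from factor_image_l[OF this] show False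
    by (intro no_run[of t "\<Phi> 2" "\<Phi> 2 @ l"])
      (use nonempty l_prefix t_suffix length_2 length_l length_t length_bounds in
        \<open>auto intro: sublist_suffix_append\<close>)
qed

lemma no_221: "[c, 2, 2, 1] \<notin> factors u"
proof
  assume "[c, 2, 2, 1] \<in> factors u"
  then have "[c, 2, 2] @ [1] \<in> factors u" by simp
  from factor_image_m[OF this] show False
    by (intro no_run[of s "\<Phi> 2" "\<Phi> 2 @ m"])
      (use nonempty m_prefix_image_m[of 2 "[]"] s_suffix length_2 length_m length_s length_bounds in
        \<open>auto intro: sublist_suffix_append\<close>)
qed

text \<open>The repetition is hardly visible in \<open>u\<close>: only the middle letter supplies a
  full period, and the images of \<open>2\<close> contribute an end \<open>t\<close> and a beginning
  \<open>m\<close> that continue it. The run is as long as in \<open>no_11\<close>.\<close>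

lemma no_212: "[2, 1, 2] \<notin> factors u"
proof
  assume "[2, 1, 2] \<in> factors u"
  then have "[2, 1] @ [2] \<in> factors u" by simp
  from factor_image_m[OF this] show False
    by (intro no_run[of t "\<Phi> 1" m])
      (use nonempty m_prefix_image_m[of 1 "[]"] t_suffix length_2 length_m length_t length_bounds in
        \<open>auto intro: sublist_suffix_append\<close>)
qed

lemma no_1010:
  assumes "d \<noteq> 0"
  shows "[c, 1, 0, 1, 0, d] \<notin> factors u"
proof
  assume "[c, 1, 0, 1, 0, d] \<in> factors u"
  then have "[c, 1, 0, 1, 0] @ [d] \<in> factors u" by simp
  from factor_image_m[OF this assms] show False
    by (intro no_run[of s "\<Phi> 1 @ \<Phi> 0" "\<Phi> 1 @ \<Phi> 0 @ m"])
      (use nonempty m_prefix_image_m[of 1 "[0]"] s_suffix length_m length_s length_bounds in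
        \<open>auto intro: sublist_suffix_append suffix_appendI\<close>)
qed

text \<open>This word cuts off the deepest branches of the searches for \<open>12\<close> and
  \<open>21\<close>. With A and B as in \<open>no_11\<close>, the period is 2 A + 3 B and the run
  has length 6 A + 17/2 B - 1.\<close>

lemma no_1210121012: "[c, 1, 2, 1, 0, 1, 2, 1, 0, 1, 2] \<notin> factors u"
proof
  assume "[c, 1, 2, 1, 0, 1, 2, 1, 0, 1, 2] \<in> factors u"
  from factor_image_l[OF this] show False
    by (intro no_run[of s "\<Phi> 1 @ \<Phi> 2 @ \<Phi> 1 @ \<Phi> 0" "\<Phi> 1 @ \<Phi> 2 @
      \<Phi> 1 @ \<Phi> 0 @ \<Phi> 1 @ \<Phi> 2 @ l"])
      (use nonempty l_prefix_image[of "[1, 0, 1, 2]"] s_suffix length_2 length_l length_s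
        length_bounds in
        \<open>auto intro!: sublist_suffix_append suffix_appendI\<close>)
qed

text \<open>Of the words to be avoided by an image of \<open>h\<close>, only \<open>12\<close> and
  \<open>21\<close> lack a direct contradiction; the search shows that they cannot recur.\<close>

lemma suffix_is_h_image:
  assumes u: "u \<in> streams (alphabet 3)" and pal: "returns_palindromic u"
  shows "\<exists>i. \<exists>v\<in>streams (alphabet 3). sdrop i u = apply_morph morph_h v"
proof -
  \<comment> \<open>The last three words are returns to a letter around a non-palindrome; the others
    force long runs. The first letter of \<open>u\<close> is given up because the runs extended by
    \<open>s\<close> need a preceding letter.\<close>
  define B :: "nat list set" where "B = {[0, 0], [1, 1], [2, 2, 2], [1, 2, 2], [2, 2, 1], [2, 1, 2],
    [1, 0, 1, 0, 1], [1, 0, 1, 0, 2], [1, 2, 1, 0, 1, 2, 1, 0, 1, 2],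
    [0, 1, 2, 0], [0, 2, 1, 0], [2, 1, 0, 2]}"
  have "y \<notin> factors (sdrop 1 u)" if y: "y \<in> B" for y
  proof
    assume "y \<in> factors (sdrop 1 u)"
    then have "y \<in> factors u" "y \<in> factors (sdrop (Suc 0) u)"
      using factors_sdropD[of y 1 u] by simp_all
    moreover from this(2) obtain c where "c # y \<in> factors u"
      using factors_extend_left[OF _ u, of y 0] by auto
    ultimately show False
      using y no_00 no_11[of c] no_222 no_122 no_221[of c] no_212 no_1010[of 1 c] no_1010[of 2 c]
        no_1210121012[of c] return_to_letter[OF pal, of 0 "[1, 2]"]
        return_to_letter[OF pal, of 0 "[2, 1]"] return_to_letter[OF pal, of 2 "[1, 0]"]
      unfolding B_def by auto
  qed
  then have bad: "x \<notin> factors (sdrop 1 u)" if "y \<in> B \<and> sublist y x" for x y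
    using that factors_sublist by blast
  have dies: "\<exists>k. x \<notin> factors (sdrop k (sdrop 1 u))"
    if "refutes (\<lambda>y x. y \<in> B \<and> sublist y x) t x" for t x
    by (rule refutes_sound[OF streams_sdrop[OF u] bad that])
  define X :: "nat list set" where "X = {[0, 0], [1, 1], [1, 2], [2, 1], [2, 2, 2]}"
  have vanish: "\<exists>k. x \<notin> factors (sdrop k (sdrop 1 u))" if x: "x \<in> X" for x
  proof -
    \<comment> \<open>Each leaf names the word of \<open>B\<close> contained in the extension
      reached.\<close>
    have refutes_12: "refutes (\<lambda>y x. y \<in> B \<and> sublist y x) (Right (Left (Leaf [0,
      1, 2, 0]) (Leaf [1, 1]) (Leaf [2, 1, 2])) (Right (Right (Leaf [0, 0]) (Right (Right (Leaf
      [0, 0]) (Leaf [1, 0, 1, 0, 1]) (Leaf [1, 0, 1, 0, 2])) (Leaf [1, 1]) (Right (Leaf [0, 1, 2,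
      0]) (Right (Right (Leaf [0, 0]) (Right (Right (Leaf [0, 0]) (Leaf [1, 0, 1, 0, 1]) (Leaf [1,
      0, 1, 0, 2])) (Leaf [1, 1]) (Leaf [1, 2, 1, 0, 1, 2, 1, 0, 1, 2])) (Leaf [2, 1, 0, 2]))
      (Leaf [1, 1]) (Leaf [2, 1, 2])) (Leaf [1, 2, 2]))) (Leaf [2, 1, 0, 2])) (Leaf [1, 1]) (Leaf
      [2, 1, 2])) (Leaf [1, 2, 2])) [1, 2]"
      by (simp add: B_def sublist_code)
    have refutes_21: "refutes (\<lambda>y x. y \<in> B \<and> sublist y x) (Right (Right (Leaf [0,
      0]) (Right (Right (Leaf [0, 0]) (Leaf [1, 0, 1, 0, 1]) (Leaf [1, 0, 1, 0, 2])) (Leaf [1, 1])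
      (Right (Leaf [0, 1, 2, 0]) (Right (Right (Leaf [0, 0]) (Right (Right (Leaf [0, 0]) (Leaf [1,
      0, 1, 0, 1]) (Leaf [1, 0, 1, 0, 2])) (Leaf [1, 1]) (Left (Leaf [0, 2, 1, 0]) (Leaf [1, 2, 1,
      0, 1, 2, 1, 0, 1, 2]) (Leaf [2, 2, 1]))) (Leaf [2, 1, 0, 2])) (Leaf [1, 1]) (Leaf [2, 1,
      2])) (Leaf [1, 2, 2]))) (Leaf [2, 1, 0, 2])) (Leaf [1, 1]) (Leaf [2, 1, 2])) [2, 1]"
      by (simp add: B_def sublist_code)
    consider "x = [1, 2]" | "x = [2, 1]" | "x \<in> B" using x by (auto simp: X_def B_def)
    then show ?thesis
    proof cases
      case 1
      then show ?thesis using dies[OF refutes_12] by simp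
    next
      case 2
      then show ?thesis using dies[OF refutes_21] by simp
    next
      case 3
      then show ?thesis by (intro dies[of "Leaf x"]) simp
    qed
  qed
  have "\<exists>k. factors (sdrop k (sdrop 1 u)) \<inter> X = {}"
    by (rule finitely_many_factors_vanish[OF _ vanish]) (simp_all add: X_def)
  then obtain k where "factors (sdrop k (sdrop 1 u)) \<inter> X = {}" by (rule exE)
  then have "\<exists>i. \<exists>v\<in>streams (alphabet 3). sdrop i (sdrop k (sdrop 1 u)) =
    apply_morph morph_h v"
    unfolding X_def by (intro h_image_suffix streams_sdrop u)
  then show ?thesis by (metis sdrop_add)
qed

end

end

section \<open>The base case\<close>

text \<open>An executable test for inner occurrences: applied to the tail of a word that begins and
  ends with \<open>q\<close>, it leaves only these two occurrences.\<close>

fun only_at_end :: "'a list \<Rightarrow> 'a list \<Rightarrow> bool" where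
  "only_at_end q [] \<longleftrightarrow> True"
| "only_at_end q (x # xs) \<longleftrightarrow> (x # xs = q \<or> \<not> prefix q (x # xs)) \<and> only_at_end q xs"

lemma only_at_endD:
  assumes "only_at_end q xs" "xs = a @ q @ b" "q \<noteq> []"
  shows "b = []"
  using assms
proof (induction xs arbitrary: a)
  case (Cons x xs)
  show ?case
  proof (cases a)
    case Nil
    then have "prefix q (x # xs)" using Cons.prems(2) by simp
    then have "x # xs = q" using Cons.prems(1) by simp
    then show ?thesis using Cons.prems(2) Nil by simp
  next
    case a: (Cons y a')
    then show ?thesis using Cons.prems Cons.IH[of a'] by simp
  qed
qed simp

text \<open>The first number is the position of the offending factor and the last one its length. The
  middle number is the period of a power, or the length of the palindrome returned to.\<close>

datatype repetition = Power nat nat nat | Return nat nat nat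

fun occurs_in :: "repetition \<Rightarrow> 'a list \<Rightarrow> bool" where
  "occurs_in (Power i p n) x \<longleftrightarrow> (let v = take n (drop i x) in
     1 \<le> p \<and> 14 * p \<le> 5 * n \<and> length v = n \<and> take (n - p) v = drop p v)"
| "occurs_in (Return i p n) x \<longleftrightarrow> (let v = take n (drop i x); q = take p v in
     1 \<le> p \<and> length v = n \<and> rev q = q \<and> drop (n - p) v = q \<and> only_at_end q (tl v) \<and> rev v \<noteq> v)"

lemma occurs_in_not_factor:
  assumes "power_free (14/5) w" "returns_palindromic w" "occurs_in r x"
  shows "x \<notin> factors w"
proof
  assume x: "x \<in> factors w"
  have sub: "take n (drop i x) \<in> factors w" for n i
    by (rule factors_sublist[OF factors_sublist[OF x sublist_drop] sublist_take])
  show False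
  proof (cases r)
    case (Power i p n)
    then show False
      using assms(3) power_free_period[OF assms(1) sub[of n i], of p] by (auto simp: Let_def)
  next
    case (Return i p n)
    define v where "v = take n (drop i x)"
    define q where "q = take p v"
    have v: "1 \<le> p" "length v = n" "rev q = q" "drop (n - p) v = q" "only_at_end q (tl v)" "rev v \<noteq> v"
      using assms(3) Return by (simp_all add: v_def q_def Let_def)
    have "v \<noteq> []" using v(6) by auto
    then have q: "q \<noteq> []" using v(1) by (simp add: q_def)
    have "a = [] \<or> b = []" if "v = a @ q @ b" for a b
      using that only_at_endD[OF v(5) _ q, of "tl a" b] by (cases a) auto
    moreover have "prefix q v" unfolding q_def by (rule take_is_prefix)
    moreover have "suffix q v" using suffix_drop[of "n - p" v] v(4) by simp
    ultimately have "rev v = v"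
      using returns_palindromicD[OF assms(2) sub[of n i, folded v_def] q v(3)] by blast
    then show False using v(6) by blast
  qed
qed

text \<open>With \<open>111\<close> excluded, consecutive zeros are separated by at most two letters
  \<open>1\<close>, which gives the three blocks of \<open>f\<close>.\<close>

lemma f_image_suffix:
  assumes "w \<in> streams (alphabet 2)" "[1, 1, 1] \<notin> factors w"
  shows "\<exists>i. \<exists>u\<in>streams (alphabet 3). sdrop i w = apply_morph morph_f u"
proof -
  define Q where "Q v \<longleftrightarrow> v \<in> streams (alphabet 2) \<and> [1, 1, 1] \<notin> factors v" for v :: "nat stream"
  have Q_w: "Q w" using assms by (simp add: Q_def)
  have Q_stl: "Q v" if "Q (a ## v)" for a v
    using that factors_SCons[of "[1, 1, 1]" v a] by (auto simp: Q_def streams_Stream)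
  have Q_start: "(a = 0 \<or> a = 1) \<and> (b = 0 \<or> b = 1) \<and> (c = 0 \<or> c = 1) \<and> \<not> (a = 1 \<and> b = 1 \<and> c = 1)"
    if "Q (a ## b ## c ## v)" for a b c v
    using that factors_shift[of "[a, b, c]" v] by (auto simp: Q_def streams_Stream alphabet_def)
  have "\<exists>a\<in>alphabet 3. \<exists>r. v = morph_f a @- r \<and> Q r \<and> shd r = 0" if v: "Q v \<and> shd v = 0" for v
  proof -
    obtain a b c d r where "v = a ## b ## c ## d ## r" by (metis stream.collapse)
    then have v_eq: "v = 0 ## b ## c ## d ## r" using v by simp
    have Q1: "Q (b ## c ## d ## r)" using v v_eq Q_stl by blast
    have Q2: "Q (c ## d ## r)" using Q1 Q_stl by blast
    have Q3: "Q (d ## r)" using Q2 Q_stl by blast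
    have "b = 0 \<or> b = 1 \<and> c = 0 \<or> b = 1 \<and> c = 1 \<and> d = 0" using Q_start[OF Q1] by auto
    then have "v = morph_f 0 @- b ## c ## d ## r \<and> b = 0 \<or> v = morph_f 1 @- c ## d ## r \<and> c = 0
        \<or> v = morph_f 2 @- d ## r \<and> d = 0"
      using v_eq by (auto simp: morph_f_def)
    then show ?thesis using Q1 Q2 Q3 by (force simp: alphabet_3)
  qed
  then have image: "\<exists>u\<in>streams (alphabet 3). s = apply_morph morph_f u" if "Q s \<and> shd s = 0" for s
    using that by (intro desubstitute[of morph_f "\<lambda>v. Q v \<and> shd v = 0"] f.\<phi>_nonempty)
  obtain a b c r where w_eq: "w = a ## b ## c ## r" by (metis stream.collapse)
  have Q1: "Q (b ## c ## r)" using Q_w w_eq Q_stl by blast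
  have Q2: "Q (c ## r)" using Q1 Q_stl by blast
  have "a = 0 \<or> b = 0 \<or> c = 0" using Q_start[of a b c r] Q_w w_eq by auto
  then have "\<exists>i. Q (sdrop i w) \<and> shd (sdrop i w) = 0"
  proof (elim disjE)
    assume "a = 0"
    then show ?thesis using Q_w w_eq by (intro exI[of _ 0]) simp
  next
    assume "b = 0"
    then show ?thesis using Q1 w_eq by (intro exI[of _ 1]) simp
  next
    assume "c = 0"
    then show ?thesis using Q2 w_eq by (intro exI[of _ 2]) (simp add: numeral_2_eq_2)
  qed
  then show ?thesis using image by blast
qed

text \<open>Some of these words only die out after a prefix: their images are harmless, but every
  sufficiently long extension of them is not.\<close>

definition forbidden :: "nat list set" where
  "forbidden = {[0, 0], [1, 1, 1], [1, 1, 2], [2, 1, 1], [2, 2, 2], [2, 1, 2, 1, 2],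
    [2, 1, 0, 2], [1, 2, 0], [1, 1, 0, 2], [1, 0, 1, 0], [1, 2, 2]}"

lemma forbidden_vanish:
  assumes u: "u \<in> streams (alphabet 3)"
    and "power_free (14/5) (apply_morph morph_f u)" "returns_palindromic (apply_morph morph_f u)"
  shows "\<exists>k. factors (sdrop k u) \<inter> forbidden = {}"
proof (rule finitely_many_factors_vanish)
  show "finite forbidden" by (simp add: forbidden_def)
  \<comment> \<open>The final \<open>0\<close> opens the image of the next letter, so it follows
    every occurrence.\<close>
  define bad where "bad r x \<longleftrightarrow> occurs_in r (concat (map morph_f x) @ [0])" for r and x :: "nat list"
  have "x \<notin> factors u" if "bad r x" for r x
    using that f.factor_image[OF _ u, of x] occurs_in_not_factor[OF assms(2,3)] by (auto simp: bad_def)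
  then have dies: "\<exists>k. x \<notin> factors (sdrop k u)" if "refutes bad t x" for t x
    using refutes_sound[of u bad t x, OF u _ that] by blast
  \<comment> \<open>Seven words have an offending image themselves; the other four need long
    extensions, with runs up to period 16 and length 45. Periods 5 and 15 with lengths 14 and 42
    meet the exponent 14/5 exactly.\<close>
  have refutations:
    "refutes bad (Leaf (Power 0 1 3)) [0, 0]"
    "refutes bad (Leaf (Power 0 2 6)) [1, 1, 1]"
    "refutes bad (Leaf (Power 0 2 6)) [1, 1, 2]"
    "refutes bad (Leaf (Power 2 2 6)) [2, 1, 1]"
    "refutes bad (Leaf (Power 0 3 9)) [2, 2, 2]"
    "refutes bad (Leaf (Power 0 5 14)) [2, 1, 2, 1, 2]"
    "refutes bad (Leaf (Return 1 2 8)) [2, 1, 0, 2]"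
    "refutes bad
    (Left (Leaf (Return 0 2 8)) (Leaf (Power 0 2 6)) (Right (Leaf (Power 8 1 3)) (Leaf (Return 3 3
     9)) (Left (Left (Leaf (Power 0 1 3)) (Leaf (Return 0 3 9)) (Right (Right (Leaf (Power 16 1 3))
     (Leaf (Return 7 3 13)) (Leaf (Power 9 4 12))) (Right (Leaf (Return 12 2 8)) (Leaf (Power 15 2
     6)) (Right (Right (Leaf (Power 21 1 3)) (Leaf (Return 16 3 9)) (Leaf (Power 0 9 26))) (Right
     (Leaf (Return 12 2 13)) (Leaf (Power 20 2 6)) (Leaf (Power 13 5 14))) (Right (Leaf (Return 12
     2 14)) (Leaf (Power 17 3 9)) (Leaf (Power 17 3 9))))) (Right (Right (Leaf (Power 19 1 3))
     (Leaf (Return 7 3 16)) (Right (Right (Leaf (Power 23 1 3)) (Leaf (Return 7 3 20)) (Leaf (Power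
     16 4 12))) (Right (Leaf (Return 19 2 8)) (Leaf (Power 22 2 6)) (Right (Right (Leaf (Power 28 1
     3)) (Leaf (Return 23 3 9)) (Right (Right (Leaf (Power 32 1 3)) (Leaf (Return 23 3 13)) (Leaf
     (Power 25 4 12))) (Right (Leaf (Return 28 2 8)) (Leaf (Power 31 2 6)) (Right (Right (Leaf
     (Power 37 1 3)) (Leaf (Return 32 3 9)) (Leaf (Power 15 9 26))) (Right (Leaf (Return 28 2 13))
     (Leaf (Power 36 2 6)) (Leaf (Power 29 5 14))) (Leaf (Return 14 5 26)))) (Right (Right (Leaf
     (Power 35 1 3)) (Leaf (Return 23 3 16)) (Right (Right (Leaf (Power 39 1 3)) (Leaf (Return 23 3
     20)) (Leaf (Power 32 4 12))) (Right (Leaf (Return 35 2 8)) (Leaf (Power 38 2 6)) (Leaf (Power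
     0 16 45))) (Right (Leaf (Power 24 7 20)) (Leaf (Return 23 3 22)) (Leaf (Power 36 3 9)))))
     (Leaf (Return 23 3 15)) (Leaf (Power 29 3 9))))) (Right (Leaf (Return 19 2 13)) (Leaf (Power
     27 2 6)) (Leaf (Power 20 5 14))) (Leaf (Return 14 5 17)))) (Right (Leaf (Power 8 7 20)) (Leaf
     (Return 7 3 22)) (Leaf (Power 20 3 9))))) (Leaf (Return 7 3 15)) (Leaf (Power 13 3 9)))))
     (Left (Leaf (Return 0 2 13)) (Leaf (Power 0 2 6)) (Leaf (Power 0 5 14))) (Left (Leaf (Return 0
     2 14)) (Leaf (Power 1 3 9)) (Leaf (Power 0 3 9))))))
    [1, 2, 0]"
    "refutes bad
    (Right (Right (Leaf (Power 8 1 3)) (Left (Left (Leaf (Power 0 1 3)) (Left (Left (Leaf (Power 0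
     1 3)) (Leaf (Power 0 3 9)) (Leaf (Return 1 2 14))) (Left (Left (Leaf (Power 0 1 3)) (Leaf
     (Power 0 5 14)) (Leaf (Power 2 5 14))) (Leaf (Power 0 2 6)) (Leaf (Power 2 2 6))) (Leaf
     (Return 1 2 13))) (Left (Left (Leaf (Power 0 1 3)) (Right (Right (Leaf (Power 18 1 3)) (Right
     (Leaf (Power 14 3 9)) (Leaf (Return 8 3 15)) (Leaf (Return 13 2 11))) (Right (Right (Leaf
     (Power 22 1 3)) (Right (Right (Leaf (Power 25 1 3)) (Right (Leaf (Power 21 3 9)) (Leaf (Return
     8 3 22)) (Leaf (Return 20 2 11))) (Leaf (Power 9 7 20))) (Right (Right (Leaf (Power 27 1 3))
     (Right (Leaf (Return 15 5 17)) (Right (Right (Leaf (Power 32 1 3)) (Leaf (Power 21 5 14))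
     (Leaf (Power 21 5 14))) (Leaf (Power 28 2 6)) (Leaf (Power 28 2 6))) (Leaf (Return 20 2 13)))
     (Right (Right (Leaf (Power 31 1 3)) (Right (Right (Leaf (Power 34 1 3)) (Right (Leaf (Power 30
     3 9)) (Leaf (Return 24 3 15)) (Leaf (Return 29 2 11))) (Right (Right (Leaf (Power 38 1 3))
     (Right (Right (Leaf (Power 41 1 3)) (Right (Leaf (Power 37 3 9)) (Leaf (Return 24 3 22)) (Leaf
     (Return 36 2 11))) (Leaf (Power 25 7 20))) (Right (Leaf (Power 0 16 45)) (Leaf (Power 39 2 6))
     (Leaf (Power 39 2 6))) (Leaf (Return 36 2 8))) (Right (Right (Leaf (Power 42 1 3)) (Leaf
     (Power 33 4 12)) (Leaf (Power 33 4 12))) (Leaf (Return 32 3 13)) (Leaf (Return 24 3 20))))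
     (Leaf (Return 32 3 9)) (Leaf (Return 24 3 16)))) (Right (Right (Leaf (Power 36 1 3)) (Right
     (Leaf (Return 15 5 26)) (Right (Right (Leaf (Power 41 1 3)) (Leaf (Power 30 5 14)) (Leaf
     (Power 30 5 14))) (Leaf (Power 37 2 6)) (Leaf (Power 37 2 6))) (Leaf (Return 29 2 13))) (Right
     (Leaf (Power 16 9 26)) (Leaf (Return 33 3 9)) (Leaf (Return 33 3 9)))) (Leaf (Power 32 2 6))
     (Leaf (Power 32 2 6))) (Leaf (Return 29 2 8))) (Right (Right (Leaf (Power 35 1 3)) (Leaf
     (Power 26 4 12)) (Leaf (Power 26 4 12))) (Leaf (Return 24 3 13)) (Leaf (Return 24 3 13))))
     (Leaf (Return 24 3 9)) (Leaf (Return 24 3 9)))) (Leaf (Power 23 2 6)) (Leaf (Power 23 2 6)))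
     (Leaf (Return 20 2 8))) (Right (Right (Leaf (Power 26 1 3)) (Leaf (Power 17 4 12)) (Leaf
     (Power 17 4 12))) (Leaf (Return 16 3 13)) (Leaf (Return 8 3 20)))) (Leaf (Return 16 3 9))
     (Leaf (Return 8 3 16)))) (Right (Right (Leaf (Power 20 1 3)) (Right (Right (Leaf (Power 23 1
     3)) (Leaf (Power 18 3 9)) (Leaf (Return 13 2 14))) (Right (Right (Leaf (Power 25 1 3)) (Leaf
     (Power 14 5 14)) (Leaf (Power 14 5 14))) (Leaf (Power 21 2 6)) (Leaf (Power 21 2 6))) (Leaf
     (Return 13 2 13))) (Right (Leaf (Power 0 9 26)) (Leaf (Return 17 3 9)) (Leaf (Return 17 3
     9)))) (Leaf (Power 16 2 6)) (Leaf (Power 16 2 6))) (Leaf (Return 13 2 8))) (Left (Left (Leaf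
     (Power 0 1 3)) (Leaf (Power 1 4 12)) (Leaf (Power 0 4 12))) (Leaf (Return 0 3 13)) (Leaf
     (Return 2 3 13)))) (Leaf (Return 0 3 9)) (Leaf (Return 2 3 9)))) (Leaf (Power 0 2 6)) (Leaf
     (Power 2 2 6))) (Right (Right (Leaf (Power 12 1 3)) (Leaf (Power 3 4 12)) (Leaf (Power 3 4
     12))) (Leaf (Return 1 3 13)) (Leaf (Return 1 3 13)))) (Leaf (Return 1 3 9)) (Leaf (Return 1 3
     9)))
    [1, 1, 0, 2]"
    "refutes bad
    (Right (Leaf (Power 5 1 3)) (Leaf (Power 0 3 9)) (Left (Leaf (Power 0 3 9)) (Right (Right (Leaf
     (Power 11 1 3)) (Right (Left (Left (Leaf (Power 0 1 3)) (Left (Left (Leaf (Power 0 1 3)) (Leaf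
     (Power 0 3 9)) (Left (Left (Leaf (Power 0 1 3)) (Left (Right (Leaf (Power 25 1 3)) (Right
     (Leaf (Power 21 3 9)) (Right (Right (Leaf (Power 30 1 3)) (Right (Right (Leaf (Power 33 1 3))
     (Leaf (Power 28 3 9)) (Right (Right (Leaf (Power 37 1 3)) (Right (Leaf (Power 0 15 42)) (Leaf
     (Return 27 3 15)) (Leaf (Return 35 2 8))) (Right (Right (Leaf (Power 41 1 3)) (Leaf (Power 32
     4 12)) (Leaf (Power 32 4 12))) (Leaf (Return 31 3 13)) (Leaf (Return 27 3 16)))) (Leaf (Return
     31 3 9)) (Leaf (Return 27 3 12)))) (Right (Leaf (Power 23 5 14)) (Leaf (Power 31 2 6)) (Leaf
     (Power 31 2 6))) (Leaf (Return 20 2 16))) (Leaf (Return 20 2 14))) (Leaf (Power 26 2 6)) (Leaf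
     (Power 26 2 6))) (Leaf (Return 20 2 11))) (Right (Right (Leaf (Power 29 1 3)) (Right (Leaf
     (Power 14 7 20)) (Leaf (Return 12 3 22)) (Leaf (Return 27 2 8))) (Right (Right (Leaf (Power 33
     1 3)) (Leaf (Power 24 4 12)) (Leaf (Power 24 4 12))) (Leaf (Return 23 3 13)) (Leaf (Return 12
     3 23)))) (Leaf (Return 23 3 9)) (Leaf (Return 12 3 19)))) (Leaf (Return 1 3 15)) (Leaf (Return
     1 2 8))) (Left (Left (Leaf (Power 0 1 3)) (Leaf (Power 1 4 12)) (Leaf (Power 0 4 12))) (Leaf
     (Return 0 3 13)) (Leaf (Return 2 3 16)))) (Leaf (Return 0 3 9)) (Leaf (Return 2 3 12)))) (Left
     (Leaf (Power 0 5 14)) (Leaf (Power 0 2 6)) (Leaf (Power 2 2 6))) (Leaf (Return 1 2 16))) (Leaf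
     (Return 1 2 14))) (Leaf (Power 0 2 6)) (Leaf (Power 2 2 6))) (Leaf (Return 1 3 15)) (Leaf
     (Return 9 2 8))) (Right (Right (Leaf (Power 15 1 3)) (Leaf (Power 6 4 12)) (Leaf (Power 6 4
     12))) (Leaf (Return 5 3 13)) (Leaf (Return 1 3 16)))) (Leaf (Return 5 3 9)) (Leaf (Return 1 3
     12))) (Leaf (Return 1 2 11))))
    [1, 0, 1, 0]"
    "refutes bad
    (Right (Left (Leaf (Return 0 2 11)) (Leaf (Power 0 2 6)) (Left (Leaf (Return 0 2 14)) (Left
     (Leaf (Return 0 2 16)) (Leaf (Power 0 2 6)) (Leaf (Power 0 5 14))) (Right (Leaf (Power 14 1
     3)) (Leaf (Return 6 3 12)) (Right (Right (Leaf (Power 18 1 3)) (Leaf (Return 6 3 16)) (Leaf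
     (Power 11 4 12))) (Leaf (Return 6 3 15)) (Left (Left (Leaf (Power 0 1 3)) (Leaf (Return 0 3
     12)) (Left (Left (Leaf (Power 0 1 3)) (Leaf (Return 0 3 16)) (Leaf (Power 0 4 12))) (Leaf
     (Return 0 3 15)) (Right (Right (Leaf (Power 28 1 3)) (Leaf (Return 13 3 19)) (Right (Right
     (Leaf (Power 32 1 3)) (Leaf (Return 13 3 23)) (Leaf (Power 25 4 12))) (Leaf (Return 13 3 22))
     (Leaf (Power 15 7 20)))) (Right (Leaf (Return 21 2 11)) (Leaf (Power 27 2 6)) (Right (Leaf
     (Return 21 2 14)) (Right (Leaf (Return 21 2 16)) (Leaf (Power 32 2 6)) (Leaf (Power 24 5 14)))
     (Right (Right (Leaf (Power 36 1 3)) (Leaf (Return 28 3 12)) (Right (Right (Leaf (Power 40 1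
     3)) (Leaf (Return 28 3 16)) (Leaf (Power 33 4 12))) (Leaf (Return 28 3 15)) (Leaf (Power 0 15
     42)))) (Leaf (Power 29 3 9)) (Leaf (Power 29 3 9))))) (Leaf (Power 22 3 9))))) (Leaf (Power 1
     3 9)) (Leaf (Power 0 3 9))))))) (Leaf (Power 1 3 9)) (Leaf (Power 1 3 9)))
    [1, 2, 2]"
    by (simp_all add: bad_def morph_f_def Let_def eval_nat_numeral)
  fix x :: "nat list"
  assume "x \<in> forbidden"
  then show "\<exists>k. x \<notin> factors (sdrop k u)"
    unfolding forbidden_def
    by (elim insertE emptyE; hypsubst) (rule dies, rule refutations)+
qed

definition forbidden_free :: "nat stream \<Rightarrow> bool" where
  "forbidden_free w \<longleftrightarrow> w \<in> streams (alphabet 3) \<and> factors w \<inter> forbidden = {}"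

lemma forbidden_free_tail: "forbidden_free (a ## v) \<Longrightarrow> forbidden_free v"
  using factors_SCons[of _ v a] by (fastforce simp: forbidden_free_def streams_Stream)

lemma forbidden_free_start:
  assumes "forbidden_free (a ## b ## c ## d ## e ## v)"
  shows "(a = 0 \<or> a = 1 \<or> a = 2) \<and> (b = 0 \<or> b = 1 \<or> b = 2) \<and> (c = 0 \<or> c = 1 \<or> c = 2) \<and>
    (d = 0 \<or> d = 1 \<or> d = 2) \<and> (e = 0 \<or> e = 1 \<or> e = 2) \<and> (a = 0 \<longrightarrow> b \<noteq> 0) \<and> (a = 1 \<and> b = 1 \<longrightarrow> c \<noteq> 1 \<and> c \<noteq> 2) \<and>
    (a = 2 \<and> b = 1 \<longrightarrow> c \<noteq> 1) \<and> (a = 1 \<and> b = 2 \<longrightarrow> c \<noteq> 0 \<and> c \<noteq> 2) \<and>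
    (a = 2 \<and> b = 1 \<and> c = 0 \<longrightarrow> d \<noteq> 2) \<and> (a = 1 \<and> b = 1 \<and> c = 0 \<longrightarrow> d \<noteq> 2) \<and>
    (a = 1 \<and> b = 0 \<and> c = 1 \<longrightarrow> d \<noteq> 0) \<and> (a = 2 \<and> b = 1 \<and> c = 2 \<and> d = 1 \<longrightarrow> e \<noteq> 2)"
proof -
  let ?F = "factors (a ## b ## c ## d ## e ## v)"
  have "[a, b] \<in> ?F" "[a, b, c] \<in> ?F" "[a, b, c, d] \<in> ?F" "[a, b, c, d, e] \<in> ?F"
    using factors_shift[of "[a, b]" "c ## d ## e ## v"] factors_shift[of "[a, b, c]" "d ## e ## v"]
      factors_shift[of "[a, b, c, d]" "e ## v"] factors_shift[of "[a, b, c, d, e]" v] by simp_all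
  then have "[a, b] \<notin> forbidden" "[a, b, c] \<notin> forbidden" "[a, b, c, d] \<notin> forbidden"
    "[a, b, c, d, e] \<notin> forbidden"
    using assms by (auto simp: forbidden_free_def)
  moreover have "a \<in> alphabet 3" "b \<in> alphabet 3" "c \<in> alphabet 3" "d \<in> alphabet 3" "e \<in> alphabet 3"
    using assms by (simp_all add: forbidden_free_def streams_Stream)
  ultimately show ?thesis by (simp add: forbidden_def alphabet_3, intro conjI impI, auto)
qed

text \<open>The words \<open>11\<close>, \<open>12\<close>, \<open>21\<close> occur in the images of \<open>g\<close> but not in those of \<open>h\<close>. The four
  patterns of \<open>g_start\<close> say that one of them occurs within the next two letters, and they
  perpetuate themselves.\<close>

lemma g_image_suffix:
  assumes "w \<in> streams (alphabet 3)" "factors w \<inter> forbidden = {}"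
    and occ: "x \<in> factors w" "x \<in> {[1, 1], [1, 2], [2, 1]}"
  shows "\<exists>i. \<exists>v\<in>streams (alphabet 3). sdrop i w = apply_morph morph_g v"
proof -
  define g_start :: "nat \<Rightarrow> nat \<Rightarrow> nat \<Rightarrow> nat \<Rightarrow> bool" where "g_start a b c d \<longleftrightarrow>
    a = 1 \<and> b \<noteq> 0 \<or> a = 2 \<and> b = 1 \<or> a = 0 \<and> b = 1 \<and> c \<noteq> 0 \<or> a = 1 \<and> b = 0 \<and> c = 1 \<and> d \<noteq> 0"
    for a b c d
  define R where "R v \<longleftrightarrow> forbidden_free v \<and> (\<exists>a b c d r. v = a ## b ## c ## d ## r \<and> g_start a b c d)" for v
  have R_stl: "R v" if R: "R (a ## v)" for a v
  proof -
    obtain b c d e f r where v: "v = b ## c ## d ## e ## f ## r" by (metis stream.collapse)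
    have Q0: "forbidden_free (a ## b ## c ## d ## e ## f ## r)" using R v by (simp add: R_def)
    have start: "g_start a b c d" using R v by (auto simp: R_def)
    have Q1: "forbidden_free (b ## c ## d ## e ## f ## r)" using Q0 by (rule forbidden_free_tail)
    have Q2: "forbidden_free (c ## d ## e ## f ## r)" using Q1 by (rule forbidden_free_tail)
    obtain g h r' where r: "r = g ## h ## r'" by (metis stream.collapse)
    have Q3: "forbidden_free (d ## e ## f ## g ## h ## r')"
      using forbidden_free_tail[OF Q2] by (simp only: r)
    have "g_start b c d e"
      using start forbidden_free_start[OF Q0] forbidden_free_start[OF Q1]
        forbidden_free_start[OF Q2[unfolded r]] forbidden_free_start[OF Q3]
      unfolding g_start_def by smt
    then show ?thesis using Q1 v unfolding R_def by blast
  qed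
  \<comment> \<open>Consecutive zeros are separated by \<open>11\<close>, \<open>121\<close> or
    \<open>12121\<close>, which gives the blocks of \<open>g\<close>; from any other letter the next
    zero is at most five places away.\<close>
  have block: "a = 0 \<and> b = 1 \<and> c = 1 \<and> d = 0 \<or> a = 0 \<and> b = 1 \<and> c = 2 \<and> d = 1 \<and> e = 0 \<or>
      a = 0 \<and> b = 1 \<and> c = 2 \<and> d = 1 \<and> e = 2 \<and> f = 1 \<and> g = 0 \<or> a \<noteq> 0 \<and> (b = 0 \<or> c = 0 \<or> d = 0 \<or> e = 0 \<or> f = 0)"
    if R: "R (a ## b ## c ## d ## e ## f ## g ## h ## k ## l ## r)" for a b c d e f g h k l r
  proof -
    have Q0: "forbidden_free (a ## b ## c ## d ## e ## f ## g ## h ## k ## l ## r)" using R by (simp add: R_def)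
    have start: "g_start a b c d" using R by (auto simp: R_def)
    have Q1: "forbidden_free (b ## c ## d ## e ## f ## g ## h ## k ## l ## r)" using Q0 by (rule forbidden_free_tail)
    have Q2: "forbidden_free (c ## d ## e ## f ## g ## h ## k ## l ## r)" using Q1 by (rule forbidden_free_tail)
    have Q3: "forbidden_free (d ## e ## f ## g ## h ## k ## l ## r)" using Q2 by (rule forbidden_free_tail)
    have Q4: "forbidden_free (e ## f ## g ## h ## k ## l ## r)" using Q3 by (rule forbidden_free_tail)
    show ?thesis
      using start forbidden_free_start[OF Q0] forbidden_free_start[OF Q1] forbidden_free_start[OF Q2]
        forbidden_free_start[OF Q3] forbidden_free_start[OF Q4]
      unfolding g_start_def by smt
  qed
  have "\<exists>a\<in>alphabet 3. \<exists>r. v = morph_g a @- r \<and> R r \<and> shd r = 0" if v: "R v \<and> shd v = 0" for v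
  proof -
    obtain a b c d e f g h k l r where v_eq: "v = a ## b ## c ## d ## e ## f ## g ## h ## k ## l ## r"
      by (metis stream.collapse)
    have a: "a = 0" using v v_eq by simp
    have R1: "R (b ## c ## d ## e ## f ## g ## h ## k ## l ## r)" using v v_eq R_stl by blast
    have R3: "R (d ## e ## f ## g ## h ## k ## l ## r)" using R1 R_stl by blast
    have R4: "R (e ## f ## g ## h ## k ## l ## r)" using R3 R_stl by blast
    have R6: "R (g ## h ## k ## l ## r)" using R4 R_stl by blast
    have "v = morph_g 0 @- d ## e ## f ## g ## h ## k ## l ## r \<and> d = 0 \<or>
        v = morph_g 1 @- e ## f ## g ## h ## k ## l ## r \<and> e = 0 \<or>
        v = morph_g 2 @- g ## h ## k ## l ## r \<and> g = 0"
      using block[of a b c d e f g h k l r] v v_eq a by (auto simp: morph_g_def)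
    then show ?thesis using R3 R4 R6 by (force simp: alphabet_3)
  qed
  then have image: "\<exists>v\<in>streams (alphabet 3). s = apply_morph morph_g v" if "R s \<and> shd s = 0" for s
    using that by (intro desubstitute[of morph_g "\<lambda>v. R v \<and> shd v = 0"] g.\<phi>_nonempty)
  obtain p s where w: "w = p @- x @- s" using occ(1) by (auto simp: factors_iff)
  obtain y1 y2 where x: "x = [y1, y2]" using occ(2) by auto
  have "sdrop (length p) w = y1 ## y2 ## s" by (simp add: w x sdrop_shift)
  moreover have "forbidden_free (sdrop (length p) w)"
    using assms(1,2) factors_sdropD[of _ "length p" w] by (auto simp: forbidden_free_def streams_sdrop)
  moreover have "g_start y1 y2 (shd s) (shd (stl s))" using occ(2) by (auto simp: x g_start_def)
  moreover have "s = shd s ## shd (stl s) ## stl (stl s)" by simp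
  ultimately have "R (sdrop (length p) w)" unfolding R_def by metis
  then have R: "R (sdrop (length p + i) w)" for i
  proof (induction i)
    case (Suc i)
    have "R (stl (sdrop (length p + i) w))"
      using Suc R_stl[of "shd (sdrop (length p + i) w)"] by (simp only: stream.collapse)
    then show ?case by (simp only: add_Suc_right sdrop.simps sdrop_stl)
  qed simp
  obtain a b c d e f g h k l r where s_eq: "sdrop (length p) w = a ## b ## c ## d ## e ## f ## g ## h ## k ## l ## r"
    by (metis stream.collapse)
  then have "a = 0 \<or> b = 0 \<or> c = 0 \<or> d = 0 \<or> e = 0 \<or> f = 0"
    using block[of a b c d e f g h k l r] R[of 0] by auto
  then have "\<exists>i\<in>{0, 1, 2, 3, 4, 5}. shd (sdrop i (sdrop (length p) w)) = 0"
    by (simp add: s_eq numeral_eq_Suc)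
  then obtain i where "shd (sdrop (length p + i) w) = 0" unfolding sdrop_add by blast
  then show ?thesis using image R by blast
qed

section \<open>The two bases of the iteration, and the theorem\<close>

lemma level_f_h: "level (\<lambda>x. concat (map morph_f (morph_h x))) [0, 0, 1] [0, 0, 1, 1, 0] [1] [0, 1, 1] 1"
  by unfold_locales (auto simp: morph_f_def morph_h_def suffix_def)

text \<open>The blocks have lengths 5, 8, 13, against 3, 4, 7 in \<open>level_f_h\<close>. The
  identity \<open>length_l\<close> then determines \<open>k\<close>: 13 - 2 * 5 = 3 here and 7 - 2 *
  3 = 1 there.\<close>

lemma level_f_g: "level (\<lambda>x. concat (map morph_f (morph_g x))) [0, 0, 1, 0, 1] [0, 0, 1, 0, 1, 1, 0, 1, 0]
    [1, 0, 1] [0, 1, 0, 1, 1, 0, 1] 3"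
  by unfold_locales (auto simp: morph_f_def morph_g_def suffix_def)

text \<open>One \<open>morph_h\<close> is peeled off a suffix of \<open>u\<close> and absorbed into
  \<open>\<Phi>\<close>, with new extensions from \<open>level_h\<close>. Freeness is inherited
  because the image of \<open>v\<close> under the enlarged morphism is a suffix of the old
  image.\<close>

lemma (in level) suffix_is_iterated_h_image:
  assumes "u \<in> streams (alphabet 3)" "returns_palindromic u" "power_free (14/5) (apply_morph \<Phi> u)"
  shows "\<exists>i. \<exists>v\<in>streams (alphabet 3).
    sdrop i (apply_morph \<Phi> u) = apply_morph \<Phi> ((apply_morph morph_h ^^ n) v)"
  using level_axioms assms
proof (induction n arbitrary: \<Phi> l m s t u)
  case 0
  then show ?case by (intro exI[of _ 0] bexI[of _ u]) simp_all
next
  case (Suc n)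
  interpret level \<Phi> l m s t k by fact
  let ?\<Psi> = "\<lambda>x. concat (map \<Phi> (morph_h x))"
  obtain i v where v: "v \<in> streams (alphabet 3)" "sdrop i u = apply_morph morph_h v"
    using suffix_is_h_image[OF Suc.prems(4,2,3)] by blast
  have "returns_palindromic v"
    using returns_palindromic_sdrop[OF Suc.prems(3), of i] v h.returns_palindromic_preimage by simp
  have comp: "apply_morph ?\<Psi> x = apply_morph \<Phi> (apply_morph morph_h x)" for x
    by (intro apply_morph_compose nonempty h.\<phi>_nonempty)
  have shift: "apply_morph ?\<Psi> v = sdrop (length (concat (map \<Phi> (stake i u)))) (apply_morph \<Phi> u)"
    by (simp add: comp flip: v(2)) (simp add: apply_morph_unfold[of \<Phi> u i, OF nonempty] sdrop_shift)
  then have "power_free (14/5) (apply_morph ?\<Psi> v)"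
    using power_free_sdrop[OF Suc.prems(4)] by simp
  from Suc.IH[OF level_h v(1) \<open>returns_palindromic v\<close> this]
  obtain j x where x: "x \<in> streams (alphabet 3)"
    "sdrop j (apply_morph ?\<Psi> v) = apply_morph ?\<Psi> ((apply_morph morph_h ^^ n) x)" by blast
  have "sdrop (length (concat (map \<Phi> (stake i u))) + j) (apply_morph \<Phi> u)
      = sdrop j (apply_morph ?\<Psi> v)" by (simp only: shift sdrop_add)
  also have "\<dots> = apply_morph \<Phi> ((apply_morph morph_h ^^ Suc n) x)" 
    unfolding x(2) unfolding comp by simp
  finally have "sdrop (length (concat (map \<Phi> (stake i u))) + j) (apply_morph \<Phi> u)
      = apply_morph \<Phi> ((apply_morph morph_h ^^ Suc n) x)" .
  then show ?case using x(1) by blast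
qed

theorem theorem1:
  fixes w :: "nat stream"
  assumes "w \<in> streams (alphabet 2)"
    and "rich_inf w"
    and "power_free (14/5) w"
  shows "\<forall>n::nat. n \<ge> 1 \<longrightarrow>
    (\<exists>m. \<exists>w\<^sub>n \<in> streams (alphabet 3).
       sdrop m w = apply_morph morph_f ((apply_morph morph_h ^^ n) w\<^sub>n) \<or>
       sdrop m w = apply_morph morph_f (apply_morph morph_g ((apply_morph morph_h ^^ n) w\<^sub>n)))"
proof (intro allI impI)
  fix n :: nat
  assume "n \<ge> 1"
  \<comment> \<open>The morphism of \<open>level_f_h\<close> already contains one \<open>h\<close>,
    so the iteration from it runs \<open>n'\<close> times; from \<open>level_f_g\<close> it runs
    \<open>n\<close> times.\<close>
  then obtain n' where n: "n = Suc n'" by (cases n) auto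
  have pal: "returns_palindromic w" using assms(2) by (rule rich_inf_returns_palindromic)
  have "[1, 1, 1] \<notin> factors w"
    using occurs_in_not_factor[OF assms(3) pal, of "Power 0 1 3"] by simp
  then obtain i u where u: "u \<in> streams (alphabet 3)" "sdrop i w = apply_morph morph_f u"
    using f_image_suffix[OF assms(1)] by blast
  have free_u: "power_free (14/5) (apply_morph morph_f u)"
    and pal_fu: "returns_palindromic (apply_morph morph_f u)"
    using power_free_sdrop[OF assms(3), of i] returns_palindromic_sdrop[OF pal, of i] u(2) by simp_all
  obtain k where k: "factors (sdrop k u) \<inter> forbidden = {}"
    using forbidden_vanish[OF u(1) free_u pal_fu] by blast
  have sk: "sdrop k u \<in> streams (alphabet 3)" using u(1) by (rule streams_sdrop)
  \<comment> \<open>The common end of both cases, with \<open>\<psi>\<close> being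
    \<open>morph_h\<close> or \<open>morph_g\<close>: suffixes of \<open>u\<close> are turned into
    suffixes of \<open>w\<close>.\<close>
  have image: "\<exists>m. \<exists>x \<in> streams (alphabet 3).
      sdrop m w = apply_morph morph_f (apply_morph \<psi> ((apply_morph morph_h ^^ n'') x))"
    if v: "v \<in> streams (alphabet 3)" "sdrop j u = apply_morph \<psi> v"
      and pal_v: "returns_palindromic v" and ne: "\<And>a. \<psi> a \<noteq> []"
      and level: "level (\<lambda>x. concat (map morph_f (\<psi> x))) l m s t d" for \<psi> j v l m s t d n''
  proof -
    let ?\<Psi> = "\<lambda>x. concat (map morph_f (\<psi> x))"
    have comp: "apply_morph ?\<Psi> x = apply_morph morph_f (apply_morph \<psi> x)" for x
      by (intro apply_morph_compose ne f.\<phi>_nonempty)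
    have shift: "apply_morph ?\<Psi> v = sdrop (i + length (concat (map morph_f (stake j u)))) w"
      unfolding comp sdrop_add[symmetric] u(2) v(2)[symmetric] apply_morph_unfold[of morph_f u j, OF f.\<phi>_nonempty]
      by (simp add: sdrop_shift)
    then have "power_free (14/5) (apply_morph ?\<Psi> v)"
      using power_free_sdrop[OF assms(3)] by simp
    from level.suffix_is_iterated_h_image[OF level v(1) pal_v this, of n''] obtain p x where
      "x \<in> streams (alphabet 3)"
      "sdrop p (apply_morph ?\<Psi> v) = apply_morph ?\<Psi> ((apply_morph morph_h ^^ n'') x)" by blast
    moreover have "sdrop p (apply_morph ?\<Psi> v)
        = sdrop (i + length (concat (map morph_f (stake j u))) + p) w" by (simp only: shift sdrop_add)
    ultimately show ?thesis unfolding comp by metis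
  qed
  have pal_u: "returns_palindromic (sdrop j u)" for j
    using f.returns_palindromic_preimage[OF u(1) pal_fu] by (rule returns_palindromic_sdrop)
  show "\<exists>m. \<exists>w\<^sub>n \<in> streams (alphabet 3).
       sdrop m w = apply_morph morph_f ((apply_morph morph_h ^^ n) w\<^sub>n) \<or>
       sdrop m w = apply_morph morph_f (apply_morph morph_g ((apply_morph morph_h ^^ n) w\<^sub>n))"
  \<comment> \<open>Without these words only the blocks of \<open>h\<close> are left; a single
    occurrence forces blocks of \<open>g\<close> from the next zero on.\<close>
  proof (cases "factors (sdrop k u) \<inter> {[1, 1], [1, 2], [2, 1]} = {}")
    case True
    then have "factors (sdrop k u) \<inter> {[0, 0], [1, 1], [1, 2], [2, 1], [2, 2, 2]} = {}"
      using k unfolding forbidden_def by blast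
    from h_image_suffix[OF sk this] obtain j v where
      v: "v \<in> streams (alphabet 3)" "sdrop (k + j) u = apply_morph morph_h v"
      by (metis sdrop_add)
    then have "returns_palindromic v"
      using h.returns_palindromic_preimage pal_u[of "k + j"] by simp
    from image[OF v this h.\<phi>_nonempty level_f_h, of n'] show ?thesis
      by (auto simp: n)
  next
    case False
    then obtain x where "x \<in> factors (sdrop k u)" "x \<in> {[1, 1], [1, 2], [2, 1]}" by blast
    from g_image_suffix[OF sk k this] obtain j v where
      v: "v \<in> streams (alphabet 3)" "sdrop (k + j) u = apply_morph morph_g v"
      by (metis sdrop_add)
    then have "returns_palindromic v"
      using g.returns_palindromic_preimage pal_u[of "k + j"] by simp
    from image[OF v this g.\<phi>_nonempty level_f_g, of n] show ?thesis by blast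
  qed
qed

end
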